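(* Let $0<\epsilon<1$ be fixed, and let $m',n',s,r$ be fixed positive integers with $s\ge r$. Let $\mathcal{A}$ be a non-trivial pattern (i.e. $r\ge2$) on the edges of the complete bipartite graph $K_{m',n'}$ with $r$ colors. Then, for all positive integers $m,n$ with $m+n$ sufficiently large (in terms of the fixed data), $$ \left(1-\epsilon\left(5s+2+(s+1)\left(\frac{m}{n}+\frac{n}{m}\right)\right)\right)\left(\frac{s-r+1}{s}\right)mn\;\le\; F(m,n;s,\mathcal{A})\;\le\;\left(\frac{s-r+1}{s}\right)mn . $$
   Context: $K_{m,n}$ is the complete bipartite graph with partite sets of sizes $m$ and $n$. A pattern with $r$ colors on the edges of a graph $G'$ is a partition $\mathcal{A}=\{A_1,\dots,A_r\}$ of $E(G')$ into $r$ nonempty, pairwise disjoint classes; it is trivial if $r=1$. An edge-coloring $c$ of $G'$ has pattern $\mathcal{A}$ if, for all edges $e,e'$, $c(e)=c(e')$ if and only if $e,e'\in A_i$ for some $i\in\{1,\dots,r\}$. For an edge-coloring $c$ of a graph $G$, one says that $G$ (colored by $c$) has, or contains, subpattern $\mathcal{A}$ if there is a subgraph $H$ of $G$ isomorphic to $G'$ such that $c$ restricted to $H$ has pattern $\mathcal{A}$ (with the edges of $H$ identified with those of $G'$ through the isomorphism). For an edge-coloring $c$ of $K_{m,n}$, $F(m,n;c,\mathcal{A})$ is the smallest number of edges of $K_{m,n}$ whose color under $c$ needs to be changed so that the resulting coloring does not contain subpattern $\mathcal{A}$. Define $$F(m,n;s,\mathcal{A})=\max\{F(m,n;c,\mathcal{A})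 : c \text{ is an edge-coloring of } K_{m,n} \text{ using } s \text{ colors}\}.$$ *)

theory Defs
  imports Complex_Main "HOL-Library.Disjoint_Sets"
begin

type_synonym 'a graph = "'a set \<times> 'a set set"

abbreviation verts :: "'a graph \<Rightarrow> 'a set" where "verts G \<equiv> fst G"
abbreviation edges :: "'a graph \<Rightarrow> 'a set set" where "edges G \<equiv> snd G"

definition simple_graph :: "'a graph \<Rightarrow> bool" where
  "simple_graph G \<longleftrightarrow> finite (verts G) \<and> (\<forall>e\<in>edges G. e \<subseteq> verts G \<and> card e = 2)"

definition subgraph_of :: "'a graph \<Rightarrow> 'a graph \<Rightarrow> bool" where
  "subgraph_of H G \<longleftrightarrow> simple_graph H \<and> verts H \<subseteq> verts G \<and> edges H \<subseteq> edges G"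

definition graph_iso :: "('a \<Rightarrow> 'b) \<Rightarrow> 'a graph \<Rightarrow> 'b graph \<Rightarrow> bool" where
  "graph_iso f G H \<longleftrightarrow> bij_betw f (verts G) (verts H) \<and>
     (\<forall>u\<in>verts G. \<forall>v\<in>verts G. {u, v} \<in> edges G \<longleftrightarrow> {f u, f v} \<in> edges H)"

definition complete_bipartite :: "nat \<Rightarrow> nat \<Rightarrow> (nat + nat) graph" where
  "complete_bipartite m n =
     (Inl ` {..<m} \<union> Inr ` {..<n}, {{Inl i, Inr j} | i j. i < m \<and> j < n})"

definition edge_pattern :: "'a graph \<Rightarrow> nat \<Rightarrow> 'a set set set \<Rightarrow> bool" where
  "edge_pattern G r \<A> \<longleftrightarrow> partition_on (edges G) \<A> \<and> finite \<A> \<and> card \<A> = r"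

text \<open>An edge-coloring is a function on all vertex sets; only its values on the edges matter.\<close>

definition has_pattern :: "'a graph \<Rightarrow> ('a set \<Rightarrow> 'c) \<Rightarrow> 'a set set set \<Rightarrow> bool" where
  "has_pattern G c \<A> \<longleftrightarrow>
     (\<forall>e\<in>edges G. \<forall>e'\<in>edges G. c e = c e' \<longleftrightarrow> (\<exists>A\<in>\<A>. e \<in> A \<and> e' \<in> A))"

text \<open>The coloring of the copy \<open>H\<close> is pulled back to \<open>G'\<close> along the isomorphism \<open>f\<close>.
  For bipartite graphs \<open>f\<close> may exchange the two sides.\<close>

definition contains_subpattern ::
    "'a graph \<Rightarrow> ('a set \<Rightarrow> 'c) \<Rightarrow> 'b graph \<Rightarrow> 'b set set set \<Rightarrow> bool" where
  "contains_subpattern G c G' \<A> \<longleftrightarrow>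
     (\<exists>H f. subgraph_of H G \<and> graph_iso f G' H \<and> has_pattern G' (\<lambda>e. c (f ` e)) \<A>)"

text \<open>Colors are natural numbers: since graphs are finite this loses no generality, and
  recoloring always has further colors at its disposal. The new coloring \<open>c'\<close> is
  arbitrary, not confined to colors already used by \<open>c\<close>.\<close>

definition F_col ::
    "nat \<Rightarrow> nat \<Rightarrow> ((nat + nat) set \<Rightarrow> nat) \<Rightarrow> 'b graph \<Rightarrow> 'b set set set \<Rightarrow> nat" where
  "F_col m n c G' \<A> =
     (LEAST k. \<exists>c' :: (nat + nat) set \<Rightarrow> nat.
        card {e \<in> edges (complete_bipartite m n). c' e \<noteq> c e} = k \<and>
        \<not> contains_subpattern (complete_bipartite m n) c' G' \<A>)"

text \<open>The set below is finite for non-trivial patterns (constant colorings avoid them, so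
  \<open>F_col\<close> is at most \<open>m * n\<close>), and it is nonempty iff \<open>1 \<le> s \<le> m * n\<close>
  when \<open>m\<close> and \<open>n\<close> are positive.\<close>

definition F_max :: "nat \<Rightarrow> nat \<Rightarrow> nat \<Rightarrow> 'b graph \<Rightarrow> 'b set set set \<Rightarrow> nat" where
  "F_max m n s G' \<A> =
     Max {F_col m n c G' \<A> | c. card (c ` edges (complete_bipartite m n)) = s}"

end

theory Submission
  imports Defs "HOL-Real_Asymp.Real_Asymp"
begin

text \<open>
  Upper bound: keep the \<open>r - 1\<close> largest color classes and recolor everything else with a kept
  color; fewer than \<open>r\<close> colors remain.

  Lower bound: list all \<open>s ^ k\<close> words of length \<open>k\<close> over the \<open>s\<close> colors as the columns of a
  \<open>k \<times> s ^ k\<close> block and tile the \<open>m \<times> n\<close> grid periodically with it. If a recoloring agrees with the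
  block on more than a fraction \<open>(r - 1) / s + \<delta>\<close> of its cells, replace in each word the letters that
  were recolored by a blank. A uniformly random word has hardly ever more than
  \<open>((r - 1) / s + \<delta>) k\<close> letters inside a product of sets of size \<open>r - 1\<close>, and partial words
  shattering few coordinates by \<open>r\<close>-sets are covered by subexponentially many such products.
  So some \<open>m' + n'\<close> rows are shattered by a single \<open>r\<close>-set of colors: \<open>m'\<close> of them carry the pattern,
  and the other \<open>n'\<close> make the chosen columns distinct. When \<open>m / n\<close> is too small or too large for
  this to apply, the left-hand side is not positive.
\<close>

section \<open>Subpatterns and the upper bound\<close>

lemma complete_bipartite_edges: "edges (complete_bipartite m n) = (\<lambda>(i, j). {Inl i, Inr j}) ` ({..<m} \<times> {..<n})"
  by (auto simp: complete_bipartite_def)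

lemma edge_iff [simp]: "{Inl i, Inr j} \<in> edges (complete_bipartite m n) \<longleftrightarrow> i < m \<and> j < n"
  by (auto simp: complete_bipartite_def doubleton_eq_iff)

lemma inj_edge: "inj_on (\<lambda>(i, j). {Inl i, Inr j}) A"
  by (auto simp: inj_on_def doubleton_eq_iff)

lemma finite_edges: "finite (edges (complete_bipartite m n))"
  by (simp add: complete_bipartite_edges)

lemma card_edges: "card (edges (complete_bipartite m n)) = m * n"
  by (simp add: complete_bipartite_edges card_image[OF inj_edge])

text \<open>The tags \<open>Inl\<close> and \<open>Inr\<close> let both endpoints be read off an
  edge, so a coloring can be prescribed cell by cell.\<close>

lemma edge_coloring_of_grid: "\<exists>c. \<forall>i j. c {Inl i, Inr j} = g i j"
proof -
  have "(THE i'. Inl i' \<in> {Inl i, Inr j}) = i" "(THE j'. Inr j' \<in> {Inl i, Inr j}) = j" for i :: 'a and j :: 'b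
    by auto
  then show ?thesis
    by (intro exI[of _ "\<lambda>e. g (THE i. Inl i \<in> e) (THE j. Inr j \<in> e)"]) simp
qed

text \<open>Representatives of different classes receive different colors in a copy, so a copy uses
  at least \<open>r\<close> colors.\<close>

lemma no_subpattern_if_few_colors:
  assumes pat: "edge_pattern (complete_bipartite m' n') r \<A>"
    and few: "card (c ` edges (complete_bipartite m n)) < r"
  shows "\<not> contains_subpattern (complete_bipartite m n) c (complete_bipartite m' n') \<A>"
proof
  let ?G = "complete_bipartite m n" and ?G' = "complete_bipartite m' n'"
  assume "contains_subpattern ?G c ?G' \<A>"
  then obtain H f where sub: "subgraph_of H ?G" and iso: "graph_iso f ?G' H"
    and has: "has_pattern ?G' (\<lambda>e. c (f ` e)) \<A>"
    by (auto simp: contains_subpattern_def)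
  have fe: "f ` e \<in> edges ?G" if "e \<in> edges ?G'" for e
  proof -
    obtain i j where ij: "e = {Inl i, Inr j}" "i < m'" "j < n'"
      using \<open>e \<in> edges ?G'\<close> by (auto simp: complete_bipartite_def)
    then have "Inl i \<in> verts ?G'" "Inr j \<in> verts ?G'"
      by (auto simp: complete_bipartite_def)
    then have "{f (Inl i), f (Inr j)} \<in> edges H"
      using iso[unfolded graph_iso_def, THEN conjunct2, rule_format, of "Inl i" "Inr j"] that ij by simp
    then show ?thesis
      using sub ij by (auto simp: subgraph_of_def)
  qed
  have part: "partition_on (edges ?G') \<A>" and "finite \<A>" and "card \<A> = r"
    using pat by (auto simp: edge_pattern_def)
  define p where "p A = (SOME e. e \<in> A)" for A :: "(nat + nat) set set"
  have p: "p A \<in> A" if "A \<in> \<A>" for A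
    using that part unfolding p_def partition_on_def by (metis ex_in_conv someI_ex)
  have pe: "p A \<in> edges ?G'" if "A \<in> \<A>" for A
    using p[OF that] that part by (auto simp: partition_on_def)
  have "inj_on (\<lambda>A. c (f ` p A)) \<A>"
  proof (rule inj_onI)
    fix A B assume AB: "A \<in> \<A>" "B \<in> \<A>" "c (f ` p A) = c (f ` p B)"
    then obtain D where "D \<in> \<A>" "p A \<in> D" "p B \<in> D"
      using has pe by (auto simp: has_pattern_def)
    then show "A = B"
      using AB p part by (metis disjointD disjoint_iff partition_onD2)
  qed
  moreover have "(\<lambda>A. c (f ` p A)) ` \<A> \<subseteq> c ` edges ?G"
    using fe pe by auto
  ultimately have "card \<A> \<le> card (c ` edges ?G)"
    by (intro card_inj_on_le) (auto simp: finite_edges)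
  then show False
    using few \<open>card \<A> = r\<close> by simp
qed

text \<open>Rows, columns and colors are chosen separately: \<open>\<rho>\<close> and
  \<open>\<gamma>\<close> place the two sides without exchanging them, and the injection
  \<open>\<beta>\<close> keeps the colors of different classes apart.\<close>

lemma contains_subpattern_if_embedding:
  assumes pat: "edge_pattern (complete_bipartite m' n') r \<A>"
    and \<rho>: "inj_on \<rho> {..<m'}" "\<rho> ` {..<m'} \<subseteq> {..<m}"
    and \<gamma>: "inj_on \<gamma> {..<n'}" "\<gamma> ` {..<n'} \<subseteq> {..<n}"
    and \<beta>: "inj_on \<beta> \<A>"
    and c: "\<And>i j A. i < m' \<Longrightarrow> j < n' \<Longrightarrow> A \<in> \<A> \<Longrightarrow> {Inl i, Inr j} \<in> A \<Longrightarrow> c {Inl (\<rho> i), Inr (\<gamma> j)} = \<beta> A"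
  shows "contains_subpattern (complete_bipartite m n) c (complete_bipartite m' n') \<A>"
proof -
  let ?G = "complete_bipartite m n" and ?G' = "complete_bipartite m' n'"
  define f where "f = map_sum \<rho> \<gamma>"
  define H where "H = (Inl ` \<rho> ` {..<m'} \<union> Inr ` \<gamma> ` {..<n'}, {{Inl (\<rho> i), Inr (\<gamma> j)} | i j. i < m' \<and> j < n'} :: (nat + nat) set set)"
  have part: "partition_on (edges ?G') \<A>"
    using pat by (auto simp: edge_pattern_def)
  have \<rho>m: "\<rho> i < m" if "i < m'" for i
    using \<rho>(2) that by auto
  have \<gamma>n: "\<gamma> j < n" if "j < n'" for j
    using \<gamma>(2) that by auto
  have "edges H \<subseteq> edges ?G"
    using \<rho>m \<gamma>n by (auto simp: H_def)
  moreover have "verts H \<subseteq> verts ?G"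
    using \<rho>(2) \<gamma>(2) by (auto simp: H_def complete_bipartite_def)
  moreover have "simple_graph H"
    by (auto simp: simple_graph_def H_def)
  ultimately have "subgraph_of H ?G"
    by (simp add: subgraph_of_def)
  moreover have "graph_iso f ?G' H"
    unfolding graph_iso_def
  proof (intro conjI ballI)
    show "bij_betw f (verts ?G') (verts H)"
      using \<rho>(1) \<gamma>(1)
      by (auto simp: bij_betw_def inj_on_def f_def H_def complete_bipartite_def image_Un image_image)
    show "{u, v} \<in> edges ?G' \<longleftrightarrow> {f u, f v} \<in> edges H" if "u \<in> verts ?G'" "v \<in> verts ?G'" for u v
      using that \<rho>(1) \<gamma>(1) unfolding f_def H_def complete_bipartite_def
      by (cases u; cases v) (auto simp: doubleton_eq_iff inj_on_def)
  qed
  moreover have "has_pattern ?G' (\<lambda>e. c (f ` e)) \<A>"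
    unfolding has_pattern_def
  proof (intro ballI)
    have key: "\<exists>A\<in>\<A>. e \<in> A \<and> c (f ` e) = \<beta> A" if "e \<in> edges ?G'" for e
    proof -
      obtain i j where ij: "e = {Inl i, Inr j}" "i < m'" "j < n'"
        using \<open>e \<in> edges ?G'\<close> by (auto simp: complete_bipartite_def)
      have "e \<in> \<Union>\<A>"
        using partition_onD1[OF part] that by simp
      then obtain A where "A \<in> \<A>" "e \<in> A"
        by blast
      moreover from this have "c (f ` e) = \<beta> A"
        using c[OF ij(2,3), of A] ij(1) by (simp add: f_def)
      ultimately show ?thesis
        by blast
    qed
    fix e e' assume "e \<in> edges ?G'" "e' \<in> edges ?G'"
    then obtain A A' where A: "A \<in> \<A>" "e \<in> A" "c (f ` e) = \<beta> A" "A' \<in> \<A>" "e' \<in> A'" "c (f ` e') = \<beta> A'"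
      using key by meson
    have uniq: "D = A" if "D \<in> \<A>" "e \<in> D" for D
      using A that part by (metis disjointD disjoint_iff partition_onD2)
    have uniq': "D = A'" if "D \<in> \<A>" "e' \<in> D" for D
      using A that part by (metis disjointD disjoint_iff partition_onD2)
    show "c (f ` e) = c (f ` e') \<longleftrightarrow> (\<exists>A\<in>\<A>. e \<in> A \<and> e' \<in> A)"
    proof
      assume "c (f ` e) = c (f ` e')"
      then have "A = A'"
        using A \<beta> by (simp add: inj_on_eq_iff)
      then show "\<exists>A\<in>\<A>. e \<in> A \<and> e' \<in> A"
        using A by blast
    next
      assume "\<exists>A\<in>\<A>. e \<in> A \<and> e' \<in> A"
      then have "A = A'"
        using uniq uniq' by blast
      then show "c (f ` e) = c (f ` e')"
        using A by simp
    qed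
  qed
  ultimately show ?thesis
    unfolding contains_subpattern_def by blast
qed

section \<open>Recoloring numbers and the upper bound\<close>

lemma F_col_le:
  assumes "\<not> contains_subpattern (complete_bipartite m n) c' G' \<A>"
  shows "F_col m n c G' \<A> \<le> card {e \<in> edges (complete_bipartite m n). c' e \<noteq> c e}"
  unfolding F_col_def using assms by (intro Least_le exI[of _ c']) simp

text \<open>One coloring without the subpattern makes the set under \<open>LEAST\<close>
  nonempty.\<close>

lemma F_col_attained:
  fixes c' :: "(nat + nat) set \<Rightarrow> nat"
  assumes "\<not> contains_subpattern (complete_bipartite m n) c' G' \<A>"
  shows "\<exists>c'. card {e \<in> edges (complete_bipartite m n). c' e \<noteq> c e} = F_col m n c G' \<A> \<and>
    \<not> contains_subpattern (complete_bipartite m n) c' G' \<A>"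
  unfolding F_col_def by (rule LeastI_ex) (use assms in auto)

text \<open>The heaviest elements carry at least their proportional share. The induction discards a
  lightest element, which cannot lower the average.\<close>

lemma exists_heavy_subset:
  fixes f :: "'a \<Rightarrow> real"
  assumes "finite C" "j \<le> card C"
  shows "\<exists>K\<subseteq>C. card K = j \<and> real j * sum f C \<le> real (card C) * sum f K"
  using assms
proof (induction "card C" arbitrary: C)
  case 0
  then show ?case by auto
next
  case (Suc n)
  show ?case
  proof (cases "j = Suc n")
    case True
    then show ?thesis
      using Suc by auto
  next
    case False
    have "C \<noteq> {}" "finite C"
      using Suc by auto
    then obtain x where x: "x \<in> C" "\<And>y. y \<in> C \<Longrightarrow> f x \<le> f y"
      using ex_min_if_finite[of "f ` C"] by (metis arg_min_if_finite(1) arg_min_least)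
    have cx: "card (C - {x}) = n"
      using x Suc by simp
    then obtain K where K: "K \<subseteq> C - {x}" "card K = j" "real j * sum f (C - {x}) \<le> real n * sum f K"
      using Suc.hyps(1)[of "C - {x}"] Suc.prems Suc.hyps(2) False by auto
    have sx: "sum f (C - {x}) = sum f C - f x"
      using x \<open>finite C\<close> by (simp add: sum_diff1)
    show ?thesis
    proof (cases "n = 0")
      case True
      then have "j = 0" using False Suc by simp
      then show ?thesis by auto
    next
      case False
      have "real n * f x \<le> sum f (C - {x})"
        using sum_bounded_below[of "C - {x}" "f x" f] x cx by simp
      then have "real n * sum f C \<le> real (Suc n) * sum f (C - {x})"
        by (simp add: sx algebra_simps)
      then have "real j * (real n * sum f C) \<le> real j * (real (Suc n) * sum f (C - {x}))"
        by (rule mult_left_mono) simp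
      also have "\<dots> \<le> real (Suc n) * (real n * sum f K)"
        using mult_left_mono[OF K(3), of "real (Suc n)"] by (simp add: algebra_simps)
      finally have "real n * (real j * sum f C) \<le> real n * (real (Suc n) * sum f K)"
        by (simp add: algebra_simps)
      then have "real j * sum f C \<le> real (card C) * sum f K"
        using False Suc.hyps(2) by simp
      then show ?thesis
        using K by blast
    qed
  qed
qed

lemma F_col_upper:
  assumes pat: "edge_pattern (complete_bipartite m' n') r \<A>"
    and r: "2 \<le> r" "r \<le> s" and s: "card (c ` edges (complete_bipartite m n)) = s"
  shows "real (F_col m n c (complete_bipartite m' n') \<A>) \<le> ((real s - real r + 1) / real s) * (real m * real n)"
proof -
  define E where "E = edges (complete_bipartite m n)"
  define f where "f x = real (card {e \<in> E. c e = x})" for x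
  have finE: "finite E" and cE: "card E = m * n"
    by (simp_all add: E_def finite_edges card_edges)
  have sumf: "sum f K = real (card {e \<in> E. c e \<in> K})" if "finite K" for K
  proof -
    have "{e \<in> E. c e \<in> K} = (\<Union>x\<in>K. {e \<in> E. c e = x})"
      by auto
    moreover have "card (\<Union>x\<in>K. {e \<in> E. c e = x}) = (\<Sum>x\<in>K. card {e \<in> E. c e = x})"
      using that finE by (intro card_UN_disjoint) auto
    ultimately show ?thesis
      by (simp add: f_def)
  qed
  have finC: "finite (c ` E)"
    using finE by simp
  have sE: "card (c ` E) = s" and "r - 1 \<le> card (c ` E)"
    using s r by (simp_all add: E_def)
  then obtain K where K: "K \<subseteq> c ` E" "card K = r - 1" "real (r - 1) * sum f (c ` E) \<le> real s * sum f K"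
    using exists_heavy_subset[OF finC, of "r - 1" f] unfolding sE by blast
  have finK: "finite K"
    using K finC finite_subset by blast
  have "{e \<in> E. c e \<in> c ` E} = E"
    by auto
  then have big: "(real r - 1) * (real m * real n) \<le> real s * real (card {e \<in> E. c e \<in> K})"
    using K(3) r cE by (simp add: sumf[OF finC] sumf[OF finK] of_nat_diff)
  \<comment> \<open>\<open>2 \<le> r\<close> leaves at least one kept color \<open>k\<close> to
    absorb all the other classes.\<close>
  have "K \<noteq> {}"
    using K(2) r by auto
  then obtain k where k: "k \<in> K"
    by blast
  define c' where "c' e = (if c e \<in> K then c e else k)" for e
  have "card (c' ` E) \<le> card K"
    using finK k by (intro card_mono) (auto simp: c'_def)
  then have "\<not> contains_subpattern (complete_bipartite m n) c' (complete_bipartite m' n') \<A>"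
    using K(2) r by (intro no_subpattern_if_few_colors[OF pat]) (auto simp: E_def)
  then have "F_col m n c (complete_bipartite m' n') \<A> \<le> card {e \<in> E. c' e \<noteq> c e}"
    unfolding E_def by (rule F_col_le)
  also have "\<dots> \<le> card (E - {e \<in> E. c e \<in> K})"
    using finE by (intro card_mono) (auto simp: c'_def)
  also have "\<dots> = m * n - card {e \<in> E. c e \<in> K}"
    using finE cE by (subst card_Diff_subset) auto
  finally have "F_col m n c (complete_bipartite m' n') \<A> \<le> m * n - card {e \<in> E. c e \<in> K}" .
  moreover have "card {e \<in> E. c e \<in> K} \<le> m * n"
    unfolding cE[symmetric] using finE by (intro card_mono) auto
  ultimately have "real (F_col m n c (complete_bipartite m' n') \<A>) \<le> real m * real n - real (card {e \<in> E. c e \<in> K})"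
    by (metis of_nat_diff of_nat_le_iff of_nat_mult)
  then have "real s * real (F_col m n c (complete_bipartite m' n') \<A>) \<le> real s * (real m * real n - real (card {e \<in> E. c e \<in> K}))"
    by (rule mult_left_mono) simp
  also have "\<dots> \<le> (real s - real r + 1) * (real m * real n)"
    using big by (simp add: algebra_simps)
  finally show ?thesis
    using r by (simp add: field_simps)
qed

text \<open>A constant coloring avoids every pattern with at least two classes, so each value is at
  most \<open>m * n\<close>. Finiteness makes the \<open>Max\<close> in \<open>F_max\<close> a true
  maximum.\<close>

lemma finite_F_col:
  assumes pat: "edge_pattern (complete_bipartite m' n') r \<A>" and r: "2 \<le> r"
  shows "finite {F_col m n c (complete_bipartite m' n') \<A> | c. card (c ` edges (complete_bipartite m n)) = s}"
proof (rule finite_subset)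
  have "card ((\<lambda>_. 0::nat) ` edges (complete_bipartite m n)) \<le> 1"
    by (simp add: image_constant_conv)
  then have "\<not> contains_subpattern (complete_bipartite m n) (\<lambda>_. 0 :: nat) (complete_bipartite m' n') \<A>"
    using r by (intro no_subpattern_if_few_colors[OF pat]) linarith
  then have "F_col m n c (complete_bipartite m' n') \<A> \<le> m * n" for c
    by (rule order_trans[OF F_col_le])
       (auto simp: card_edges[symmetric] intro: card_mono finite_edges)
  then show "{F_col m n c (complete_bipartite m' n') \<A> | c. card (c ` edges (complete_bipartite m n)) = s} \<subseteq> {..m * n}"
    by auto
qed simp

section \<open>Shattering by partial words\<close>

text \<open>In \<open>t\<close> an entry \<open>Some T\<close> marks a coordinate on which every letter of \<open>T\<close> has to occur, in all
  combinations; at entries \<open>None\<close> anything goes, blanks included.\<close>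

fun shatters :: "'a option list set \<Rightarrow> 'a set option list \<Rightarrow> bool" where
  "shatters S [] \<longleftrightarrow> S \<noteq> {}"
| "shatters S (None # t) \<longleftrightarrow> shatters (tl ` S) t"
| "shatters S (Some T # t) \<longleftrightarrow> (\<forall>b\<in>T. shatters {u. Some b # u \<in> S} t)"

lemma shatters_mono: "shatters S t \<Longrightarrow> S \<subseteq> S' \<Longrightarrow> shatters S' t"
proof (induction t arbitrary: S S')
  case Nil
  then show ?case by auto
next
  case (Cons a t)
  show ?case
  proof (cases a)
    case None
    then show ?thesis
      using Cons.IH[of "tl ` S" "tl ` S'"] Cons.prems by auto
  next
    case (Some T)
    have "shatters {u. Some b # u \<in> S'} t" if "b \<in> T" for b
      using Cons.IH[of "{u. Some b # u \<in> S}" "{u. Some b # u \<in> S'}"] Cons.prems that Some by auto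
    then show ?thesis
      using Some by simp
  qed
qed

lemma shatters_replicate_None: "S \<noteq> {} \<Longrightarrow> shatters S (replicate n None)"
  by (induction n arbitrary: S) auto

text \<open>Unfolding the recursion: a letter may be prescribed freely from each marked set, and
  some member of \<open>S\<close> shows all of them at once, unblanked. In this form shattering
  later produces the columns of a copy.\<close>

lemma shatters_realizes:
  assumes "shatters S t"
    and "\<And>u. u \<in> S \<Longrightarrow> length u = length t"
    and "\<And>i T. i < length t \<Longrightarrow> t ! i = Some T \<Longrightarrow> w i \<in> T"
  shows "\<exists>u\<in>S. \<forall>i<length t. t ! i \<noteq> None \<longrightarrow> u ! i = Some (w i)"
  using assms
proof (induction t arbitrary: S w)
  case Nil
  then show ?case by auto
next
  case (Cons a t)
  have w: "w (Suc i) \<in> T" if "i < length t" "t ! i = Some T" for i T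
    using Cons.prems(3)[of "Suc i" T] that by simp
  show ?case
  proof (cases a)
    case None
    have "\<exists>u\<in>tl ` S. \<forall>i<length t. t ! i \<noteq> None \<longrightarrow> u ! i = Some (w (Suc i))"
      using Cons.prems(1,2) None w by (intro Cons.IH) auto
    then obtain u where u: "u \<in> S" "\<forall>i<length t. t ! i \<noteq> None \<longrightarrow> tl u ! i = Some (w (Suc i))"
      by auto
    then have "length u = Suc (length t)"
      using Cons.prems(2) by auto
    then have "\<forall>i<length (a # t). (a # t) ! i \<noteq> None \<longrightarrow> u ! i = Some (w i)"
      using u(2) None by (cases u) (auto simp: nth_Cons split: nat.split)
    then show ?thesis
      using u(1) by blast
  next
    case (Some T)
    have b: "w 0 \<in> T"
      using Cons.prems(3)[of 0 T] Some by simp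
    have "\<exists>u\<in>{u. Some (w 0) # u \<in> S}. \<forall>i<length t. t ! i \<noteq> None \<longrightarrow> u ! i = Some (w (Suc i))"
    proof (rule Cons.IH)
      show "shatters {u. Some (w 0) # u \<in> S} t"
        using Cons.prems(1) Some b by simp
      show "length u = length t" if "u \<in> {u. Some (w 0) # u \<in> S}" for u
        using Cons.prems(2)[of "Some (w 0) # u"] that by simp
    qed (use w in auto)
    then obtain u where u: "Some (w 0) # u \<in> S" "\<forall>i<length t. t ! i \<noteq> None \<longrightarrow> u ! i = Some (w (Suc i))"
      by auto
    then have "\<forall>i<length (a # t). (a # t) ! i \<noteq> None \<longrightarrow> (Some (w 0) # u) ! i = Some (w i)"
      by (auto simp: nth_Cons split: nat.split)
    then show ?thesis
      using u(1) by blast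
  qed
qed

text \<open>The number of these patterns measures the complexity of \<open>S\<close>, in the role
  that the number of shattered sets has for the Sauer-Shelah lemma.\<close>

definition shattered :: "'a set set \<Rightarrow> nat \<Rightarrow> 'a option list set \<Rightarrow> 'a set option list set" where
  "shattered \<T> n S = {t. set t \<subseteq> insert None (Some ` \<T>) \<and> length t = n \<and> shatters S t}"

lemma finite_shattered: "finite \<T> \<Longrightarrow> finite (shattered \<T> n S)"
  by (rule finite_subset[OF _ finite_lists_length_eq[of "insert None (Some ` \<T>)" n]])
     (auto simp: shattered_def)

lemma card_shattered_mono:
  "finite \<T> \<Longrightarrow> S \<subseteq> S' \<Longrightarrow> card (shattered \<T> n S) \<le> card (shattered \<T> n S')"
  by (rule card_mono[OF finite_shattered]) (auto simp: shattered_def intro: shatters_mono)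

text \<open>The pattern consisting of \<open>None\<close> only is shattered by every nonempty
  \<open>S\<close>.\<close>

lemma card_shattered_pos: "finite \<T> \<Longrightarrow> S \<noteq> {} \<Longrightarrow> 0 < card (shattered \<T> n S)"
proof -
  assume "finite \<T>" "S \<noteq> {}"
  moreover have "replicate n None \<in> shattered \<T> n S"
    using \<open>S \<noteq> {}\<close> by (auto simp: shattered_def shatters_replicate_None)
  ultimately show ?thesis
    using finite_shattered card_gt_0_iff by blast
qed

lemma card_shattered_tl:
  assumes "finite \<T>"
  shows "card (shattered \<T> n (tl ` S)) \<le> card (shattered \<T> (Suc n) S)"
  by (rule card_inj_on_le[where f = "(#) None"])
     (auto simp: shattered_def intro: finite_shattered[OF assms, unfolded shattered_def])

text \<open>The two summands count patterns beginning with \<open>None\<close> and with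
  \<open>Some T\<close>; these are disjoint kinds.\<close>

lemma card_shattered_Suc_ge:
  assumes fin: "finite \<T>" and T: "T \<in> \<T>"
  shows "card (shattered \<T> n (tl ` S)) + card {t \<in> shattered \<T> n (tl ` S). \<forall>b\<in>T. t \<in> shattered \<T> n {u. Some b # u \<in> S}}
    \<le> card (shattered \<T> (Suc n) S)" (is "card ?A + card ?B \<le> _")
proof -
  have "card ?A + card ?B = card ((#) None ` ?A) + card ((#) (Some T) ` ?B)"
    by (simp add: card_image)
  also have "\<dots> = card ((#) None ` ?A \<union> (#) (Some T) ` ?B)"
    using finite_shattered[OF fin] by (intro card_Un_disjoint[symmetric]) auto
  also have "\<dots> \<le> card (shattered \<T> (Suc n) S)"
    using T by (intro card_mono finite_shattered fin) (auto simp: shattered_def)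
  finally show ?thesis .
qed

text \<open>A pattern shattered after each of the \<open>r\<close> letters of \<open>T\<close> is counted twice for \<open>S\<close>: once with
  \<open>None\<close> and once with \<open>Some T\<close> in front. Hence at most \<open>r - 1\<close> letters can keep more than the
  fraction \<open>(r - 1) / r\<close> of the shattered patterns.\<close>

lemma shattered_halving:
  assumes fin: "finite \<T>" and T: "T \<in> \<T>" and r: "card T = r" "2 \<le> r"
  shows "\<exists>b\<in>T. r * card (shattered \<T> n {u. Some b # u \<in> S}) \<le> (r - 1) * card (shattered \<T> (Suc n) S)"
proof (rule ccontr)
  define A where "A = shattered \<T> n (tl ` S)"
  define Q where "Q b = shattered \<T> n {u. Some b # u \<in> S}" for b
  define B where "B = {t \<in> A. \<forall>b\<in>T. t \<in> Q b}"
  define N where "N = card (shattered \<T> (Suc n) S)"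
  assume "\<not> ?thesis"
  then have big: "(r - 1) * N < r * card (Q b)" if "b \<in> T" for b
    using that by (force simp: Q_def N_def not_le)
  have finT: "finite T" and finA: "finite A"
    using r card.infinite by (fastforce, simp add: A_def finite_shattered fin)
  have QA: "Q b \<subseteq> A" for b
    unfolding Q_def A_def shattered_def by (force intro: shatters_mono)
  \<comment> \<open>A pattern in \<open>A\<close> outside \<open>B\<close> is missing from some
    \<open>Q b\<close>, which gives a union bound over the letters of \<open>T\<close>.\<close>
  have "card (A - B) \<le> (\<Sum>b\<in>T. card (A - Q b))"
  proof -
    have "A - B = (\<Union>b\<in>T. A - Q b)"
      by (auto simp: B_def)
    then show ?thesis
      using card_UN_le[OF finT, of "\<lambda>b. A - Q b"] by metis
  qed
  then have "real (card (A - B)) \<le> (\<Sum>b\<in>T. real (card (A - Q b)))"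
    by (simp flip: of_nat_sum)
  moreover have "real (card (A - D)) = real (card A) - real (card D)" if "D \<subseteq> A" for D
    using that finA by (simp add: card_Diff_subset[OF finite_subset] card_mono of_nat_diff)
  moreover have "B \<subseteq> A"
    by (auto simp: B_def)
  ultimately have "real (card A) - real (card B) \<le> (\<Sum>b\<in>T. real (card A) - real (card (Q b)))"
    using QA by simp
  then have 1: "real r * (real (card A) - real (card B)) \<le> (\<Sum>b\<in>T. real r * (real (card A) - real (card (Q b))))"
    by (simp add: sum_distrib_left[symmetric] mult_left_mono)
  have "real r * (real (card A) - real (card (Q b))) < real r * card A - (real r - 1) * N" if "b \<in> T" for b
    using big[OF that] r by (simp add: algebra_simps of_nat_diff flip: of_nat_mult of_nat_less_iff)
  then have 2: "(\<Sum>b\<in>T. real r * (real (card A) - real (card (Q b)))) < (\<Sum>b\<in>T. real r * card A - (real r - 1) * N)"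
    using finT r by (intro sum_strict_mono) auto
  have "real r * (real (card A) - real (card B)) < real r * (real r * card A - (real r - 1) * N)"
    using order_le_less_trans[OF 1 2] r by (simp only: sum_constant)
  then have "real (card A) - real (card B) < real r * card A - (real r - 1) * N"
    using r by (simp add: mult_less_cancel_left_pos del: mult_less_cancel_left mult_less_cancel_left_disj)
  moreover have "card A + card B \<le> N"
    using card_shattered_Suc_ge[OF fin T] by (simp add: A_def B_def Q_def N_def)
  then have AB: "real (card A) + card B \<le> N"
    by (metis of_nat_add of_nat_le_iff)
  \<comment> \<open>So far \<open>card A + card B > (r - 1) * N - (r - 2) * card A\<close>. Since
    \<open>2 \<le> r\<close> and \<open>card A \<le> N\<close>, the right side is at least
    \<open>N\<close>, against \<open>AB\<close>.\<close>
  moreover have "(real r - 2) * card A \<le> (real r - 2) * N"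
    using r AB by (intro mult_left_mono) auto
  ultimately show False
    by (simp add: algebra_simps)
qed

text \<open>Counts the surviving letters of a blanked word, and also the marked coordinates of a
  pattern.\<close>

definition nsome :: "'a option list \<Rightarrow> nat" where
  "nsome u = length (filter (\<lambda>x. x \<noteq> None) u)"

lemma nsome_simps [simp]:
  "nsome [] = 0" "nsome (None # u) = nsome u" "nsome (Some x # u) = Suc (nsome u)"
  by (simp_all add: nsome_def)

text \<open>Reading the words letter by letter, the at most \<open>r - 1\<close> letters in the set \<open>B\<close> of the proof
  contribute the factor \<open>\<theta>\<close>; every unblanked letter outside \<open>B\<close> uses up one of the \<open>l\<close> halvings,
  at one of at most \<open>n\<close> positions.\<close>

lemma weighted_count_bound:
  fixes \<theta> :: real and C :: "'a set" and r :: nat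
  defines "\<T> \<equiv> {T. T \<subseteq> C \<and> card T = r}"
  assumes C: "finite C" "card C = s" and r: "2 \<le> r" and \<theta>: "1 \<le> \<theta>"
    and W: "W \<subseteq> {v. set v \<subseteq> C \<and> length v = n}"
    and h: "\<And>v. v \<in> W \<Longrightarrow> list_all2 (\<lambda>x y. y = None \<or> y = Some x) v (h v)"
    and N: "real (card (shattered \<T> n (h ` W))) < (real r / (real r - 1)) ^ l"
  shows "(\<Sum>v\<in>W. \<theta> ^ nsome (h v)) \<le> (real s + (\<theta> - 1) * (real r - 1)) ^ n * (1 + real n * \<theta>) ^ l"
  using W h N
proof (induction n arbitrary: W h l)
  case 0
  then have "W \<subseteq> {[]}"
    by auto
  then have "W = {} \<or> W = {[]}"
    by auto
  then show ?case
    using 0 by auto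
next
  case (Suc n)
  define q where "q = real s + (\<theta> - 1) * (real r - 1)"
  have q: "real s \<le> q"
    using \<theta> r by (simp add: q_def)
  have fin: "finite \<T>"
    unfolding \<T>_def by (rule finite_subset[of _ "Pow C"]) (use C in auto)
  have q0: "0 \<le> q"
    using q of_nat_0_le_iff order_trans by blast
  define S where "S = h ` W"
  have finW: "finite W"
    using Suc.prems(1) finite_lists_length_eq[OF C(1)] finite_subset by blast
  show ?case
  proof (cases l)
    case 0
    \<comment> \<open>With \<open>l = 0\<close> fewer than one pattern is shattered, which forces
      \<open>W\<close> to be empty.\<close>
    then have "card (shattered \<T> (Suc n) S) = 0"
      using Suc.prems(3) by (simp add: S_def)
    then have "S = {}"
      using card_shattered_pos[OF fin, of S "Suc n"] by linarith
    then show ?thesis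
      using q0 \<theta> unfolding S_def q_def[symmetric] by simp
  next
    case (Suc l')
    define x where "x = 1 + real n * \<theta>"
    have x: "1 \<le> x"
      using \<theta> by (simp add: x_def)
    define NS where "NS = card (shattered \<T> (Suc n) S)"
    define Nb where "Nb b = card (shattered \<T> n {u. Some b # u \<in> S})" for b
    \<comment> \<open>The letters that may keep more than \<open>(r - 1) / r\<close> of the
      shattered patterns; an \<open>r\<close>-subset of \<open>B\<close> would contradict
      \<open>shattered_halving\<close>.\<close>
    define B where "B = {b \<in> C. (r - 1) * NS < r * Nb b}"
    have BC: "B \<subseteq> C"
      by (auto simp: B_def)
    have cardB: "card B \<le> r - 1"
    proof (rule ccontr)
      assume "\<not> card B \<le> r - 1"
      then obtain T where T: "T \<subseteq> B" "card T = r"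
        by (metis Suc_pred' less_or_eq_imp_le not_less_eq_eq obtain_subset_with_card_n r zero_less_diff
            Suc_le_lessD diff_is_0_eq' not_le numeral_2_eq_2 zero_less_Suc less_le_trans)
      then have "T \<in> \<T>"
        using BC by (auto simp: \<T>_def)
      from shattered_halving[OF fin this T(2) r, of n S] T show False
        by (force simp: B_def NS_def Nb_def)
    qed
    define Wb where "Wb b = {v. b # v \<in> W}" for b
    define W0 where "W0 b = {v \<in> Wb b. hd (h (b # v)) = None}" for b
    define W1 where "W1 b = {v \<in> Wb b. hd (h (b # v)) \<noteq> None}" for b
    define g where "g b v = tl (h (b # v))" for b v
    have hW: "h (b # v) = None # g b v \<or> h (b # v) = Some b # g b v"
      and gall: "list_all2 (\<lambda>x y. y = None \<or> y = Some x) v (g b v)" if "v \<in> Wb b" for b v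
      using Suc.prems(2)[of "b # v"] that by (auto simp: Wb_def g_def list_all2_Cons1)
    have NSl: "real NS < (real r / (real r - 1)) ^ Suc l'"
      using Suc.prems(3) Suc by (simp add: NS_def S_def)
    have Wbl: "Wb b \<subseteq> {v. set v \<subseteq> C \<and> length v = n}" for b
      using Suc.prems(1) by (fastforce simp: Wb_def)
    have finWb: "finite (Wb b)" for b
      using Wbl finite_lists_length_eq[OF C(1)] finite_subset by blast
    \<comment> \<open>Dropping the first letter cannot raise the number of shattered patterns, so
      the induction hypothesis applies with the same exponent \<open>l\<close>.\<close>
    have full: "(\<Sum>v\<in>W'. \<theta> ^ nsome (g b v)) \<le> q ^ n * x ^ Suc l'" if "W' \<subseteq> Wb b" for b W'
      unfolding q_def x_def
    proof (rule Suc.IH)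
      have "g b ` W' \<subseteq> tl ` S"
        using that by (auto simp: g_def S_def Wb_def)
      then have "card (shattered \<T> n (g b ` W')) \<le> NS"
        unfolding NS_def by (intro order_trans[OF card_shattered_mono[OF fin] card_shattered_tl[OF fin]])
      then show "real (card (shattered \<T> n (g b ` W'))) < (real r / (real r - 1)) ^ Suc l'"
        using NSl by linarith
    qed (use that Wbl gall in blast)+
    \<comment> \<open>For an unblanked letter outside \<open>B\<close> the count shrinks by
      \<open>(r - 1) / r\<close>, which buys an exponent smaller by one.\<close>
    have small: "(\<Sum>v\<in>W1 b. \<theta> ^ nsome (g b v)) \<le> q ^ n * x ^ l'" if "b \<in> C - B" for b
      unfolding q_def x_def
    proof (rule Suc.IH)
      have "g b ` W1 b \<subseteq> {u. Some b # u \<in> S}"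
        using hW by (force simp: W1_def S_def Wb_def)
      then have "card (shattered \<T> n (g b ` W1 b)) \<le> Nb b"
        unfolding Nb_def by (rule card_shattered_mono[OF fin])
      moreover have "r * Nb b \<le> (r - 1) * NS"
        using that by (auto simp: B_def)
      then have "real r * Nb b \<le> (real r - 1) * NS"
        using r of_nat_mono[of "r * Nb b" "(r - 1) * NS", where 'a = real] by (simp add: of_nat_diff)
      moreover have "(real r - 1) * NS < (real r - 1) * (real r / (real r - 1)) ^ Suc l'"
        using NSl r by (intro mult_strict_left_mono) auto
      moreover have "(real r - 1) * (real r / (real r - 1)) ^ Suc l' = real r * (real r / (real r - 1)) ^ l'"
        using r by simp
      ultimately have "real r * Nb b < real r * (real r / (real r - 1)) ^ l'"
        by linarith
      then have "Nb b < (real r / (real r - 1)) ^ l'"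
        using r by simp
      then show "real (card (shattered \<T> n (g b ` W1 b))) < (real r / (real r - 1)) ^ l'"
        using \<open>card (shattered \<T> n (g b ` W1 b)) \<le> Nb b\<close> by linarith
      show "W1 b \<subseteq> {v. set v \<subseteq> C \<and> length v = n}"
        using Wbl by (force simp: W1_def)
      show "list_all2 (\<lambda>x y. y = None \<or> y = Some x) v (g b v)" if "v \<in> W1 b" for v
        using gall that by (simp add: W1_def)
    qed
    \<comment> \<open>A blanked first letter contributes the factor 1, which is at most the factor
      \<open>\<theta>\<close> of a surviving one.\<close>
    have inB: "(\<Sum>v\<in>Wb b. \<theta> ^ nsome (h (b # v))) \<le> \<theta> * (q ^ n * x ^ Suc l')" for b
    proof -
      have "(\<Sum>v\<in>Wb b. \<theta> ^ nsome (h (b # v))) \<le> (\<Sum>v\<in>Wb b. \<theta> * \<theta> ^ nsome (g b v))"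
      proof (rule sum_mono)
        fix v assume "v \<in> Wb b"
        from hW[OF this] show "\<theta> ^ nsome (h (b # v)) \<le> \<theta> * \<theta> ^ nsome (g b v)"
          using \<theta> by auto
      qed
      also have "\<dots> \<le> \<theta> * (q ^ n * x ^ Suc l')"
        unfolding sum_distrib_left[symmetric] using \<theta> full[of "Wb b" b] by (intro mult_left_mono) auto
      finally show ?thesis .
    qed
    have notB: "(\<Sum>v\<in>Wb b. \<theta> ^ nsome (h (b # v))) \<le> q ^ n * x ^ Suc l' + \<theta> * (q ^ n * x ^ l')"
      if "b \<in> C - B" for b
    proof -
      have "Wb b = W0 b \<union> W1 b" "W0 b \<inter> W1 b = {}" "finite (W0 b)" "finite (W1 b)"
        using finWb by (auto simp: W0_def W1_def)
      then have "(\<Sum>v\<in>Wb b. \<theta> ^ nsome (h (b # v))) =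
          (\<Sum>v\<in>W0 b. \<theta> ^ nsome (h (b # v))) + (\<Sum>v\<in>W1 b. \<theta> ^ nsome (h (b # v)))"
        by (simp add: sum.union_disjoint)
      also have "(\<Sum>v\<in>W0 b. \<theta> ^ nsome (h (b # v))) = (\<Sum>v\<in>W0 b. \<theta> ^ nsome (g b v))"
        using hW by (intro sum.cong) (force simp: W0_def)+
      also have "(\<Sum>v\<in>W1 b. \<theta> ^ nsome (h (b # v))) = \<theta> * (\<Sum>v\<in>W1 b. \<theta> ^ nsome (g b v))"
        unfolding sum_distrib_left using hW by (intro sum.cong) (force simp: W1_def)+
      also have "(\<Sum>v\<in>W0 b. \<theta> ^ nsome (g b v)) \<le> q ^ n * x ^ Suc l'"
        by (rule full) (auto simp: W0_def)
      also have "\<theta> * (\<Sum>v\<in>W1 b. \<theta> ^ nsome (g b v)) \<le> \<theta> * (q ^ n * x ^ l')"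
        using small[OF that] \<theta> by (intro mult_left_mono) auto
      finally show ?thesis
        by simp
    qed
    have "W = (\<Union>b\<in>C. (#) b ` Wb b)"
    proof -
      have "\<exists>b\<in>C. \<exists>v. w = b # v" if "w \<in> W" for w
        using Suc.prems(1) that by (cases w) auto
      then show ?thesis
        by (auto simp: Wb_def) (metis imageI mem_Collect_eq)
    qed
    then have "(\<Sum>v\<in>W. \<theta> ^ nsome (h v)) = (\<Sum>b\<in>C. \<Sum>v\<in>(#) b ` Wb b. \<theta> ^ nsome (h v))"
      using C finWb by (simp, intro sum.UNION_disjoint) auto
    also have "\<dots> = (\<Sum>b\<in>C. \<Sum>v\<in>Wb b. \<theta> ^ nsome (h (b # v)))"
      by (simp add: sum.reindex)
    also have "\<dots> = (\<Sum>b\<in>B. \<Sum>v\<in>Wb b. \<theta> ^ nsome (h (b # v))) + (\<Sum>b\<in>C - B. \<Sum>v\<in>Wb b. \<theta> ^ nsome (h (b # v)))"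
      using BC C by (simp add: sum.subset_diff add.commute)
    also have "\<dots> \<le> (\<Sum>b\<in>B. \<theta> * (q ^ n * x ^ Suc l')) + (\<Sum>b\<in>C - B. q ^ n * x ^ Suc l' + \<theta> * (q ^ n * x ^ l'))"
      using inB notB by (intro add_mono sum_mono) auto
    also have "\<dots> = (real s + (\<theta> - 1) * card B) * (q ^ n * x ^ Suc l') + (real s - card B) * (\<theta> * (q ^ n * x ^ l'))"
    proof -
      have "real (card (C - B)) = real s - card B"
        using BC C by (simp add: card_Diff_subset finite_subset of_nat_diff card_mono flip: C(2))
      then show ?thesis
        by (simp only: sum_constant) (simp add: algebra_simps)
    qed
    \<comment> \<open>The first coefficient reaches \<open>q\<close> at
      \<open>card B = r - 1\<close>; the second is estimated crudely.\<close>
    also have "\<dots> \<le> q * (q ^ n * x ^ Suc l') + q * (\<theta> * (q ^ n * x ^ l'))"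
    proof (intro add_mono mult_right_mono)
      have "real (card B) \<le> real r - 1"
        using cardB r by linarith
      then show "real s + (\<theta> - 1) * card B \<le> q"
        unfolding q_def using \<theta> by (intro add_left_mono mult_left_mono) auto
      show "real s - card B \<le> q"
        using q by linarith
    qed (use q0 x \<theta> in auto)
    \<comment> \<open>Since \<open>x + \<theta> = 1 + real (Suc n) * \<theta>\<close>, the
      additional position pays for the case of an unblanked letter outside \<open>B\<close>.\<close>
    also have "\<dots> = q ^ Suc n * x ^ l' * (x + \<theta>)"
      by (simp add: algebra_simps)
    also have "\<dots> \<le> q ^ Suc n * (x + \<theta>) ^ l' * (x + \<theta>)"
      using x \<theta> q0 by (intro mult_right_mono mult_left_mono power_mono) auto
    also have "\<dots> = q ^ Suc n * (1 + real (Suc n) * \<theta>) ^ l"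
      unfolding Suc x_def by (simp add: algebra_simps)
    finally show ?thesis
      unfolding q_def .
  qed
qed

section \<open>Counting patterns with few marks\<close>

lemma finite_few_somes:
  "finite \<T> \<Longrightarrow> finite {t. set t \<subseteq> insert None (Some ` \<T>) \<and> length t = n \<and> nsome t \<le> d}"
  by (rule finite_subset[OF _ finite_lists_length_eq[of "insert None (Some ` \<T>)" n]]) auto

text \<open>By the first entry: \<open>None\<close> leaves all \<open>d\<close> marks to the tail,
  while \<open>Some T\<close> leaves \<open>d - 1\<close> and has \<open>card \<T>\<close> choices.
  For fixed \<open>d\<close> the bound is polynomial in \<open>n\<close>.\<close>

lemma card_few_somes:
  assumes "finite \<T>"
  shows "card {t. set t \<subseteq> insert None (Some ` \<T>) \<and> length t = n \<and> nsome t \<le> d} \<le> (1 + n * card \<T>) ^ d"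
proof (induction n arbitrary: d)
  case 0
  have "{t. set t \<subseteq> insert None (Some ` \<T>) \<and> length t = 0 \<and> nsome t \<le> d} = {[]}"
    by auto
  then show ?case by simp
next
  case (Suc n)
  define A where "A n d = {t. set t \<subseteq> insert None (Some ` \<T>) \<and> length t = n \<and> nsome t \<le> d}" for n d
  have finA: "finite (A n d)" for n d
    unfolding A_def by (rule finite_few_somes[OF assms])
  have IH: "card (A n d) \<le> (1 + n * card \<T>) ^ d" for d
    using Suc by (simp add: A_def)
  show ?case
  proof (cases d)
    case 0
    have "A (Suc n) 0 \<subseteq> (#) None ` A n 0"
      by (auto simp: A_def length_Suc_conv)
    then have "card (A (Suc n) 0) \<le> card (A n 0)"
      by (meson finA surj_card_le)
    then show ?thesis
      using IH[of 0] 0 by (simp add: A_def)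
  next
    case (Suc e)
    define y where "y = 1 + n * card \<T>"
    have "A (Suc n) d \<subseteq> (#) None ` A n d \<union> (\<lambda>(T, t). Some T # t) ` (\<T> \<times> A n e)"
      using Suc by (auto simp: A_def length_Suc_conv image_iff)
    then have "card (A (Suc n) d) \<le> card ((#) None ` A n d \<union> (\<lambda>(T, t). Some T # t) ` (\<T> \<times> A n e))"
      using finA assms by (intro card_mono) auto
    also have "\<dots> \<le> card ((#) None ` A n d) + card ((\<lambda>(T, t). Some T # t) ` (\<T> \<times> A n e))"
      by (rule card_Un_le)
    also have "\<dots> \<le> card (A n d) + card (\<T> \<times> A n e)"
      using finA assms by (intro add_mono card_image_le) auto
    also have "\<dots> = card (A n d) + card \<T> * card (A n e)"
      by (simp add: card_cartesian_product)
    also have "\<dots> \<le> y ^ d + card \<T> * y ^ e"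
      using IH unfolding y_def by (intro add_mono mult_left_mono) auto
    also have "\<dots> = y ^ e * (y + card \<T>)"
      using Suc by (simp add: algebra_simps)
    also have "\<dots> \<le> (y + card \<T>) ^ e * (y + card \<T>)"
      by (intro mult_right_mono power_mono) auto
    also have "\<dots> = (1 + Suc n * card \<T>) ^ d"
      using Suc by (simp add: y_def algebra_simps)
    finally show ?thesis
      by (simp add: A_def)
  qed
qed

section \<open>Blocks with large agreement\<close>

text \<open>An \<open>l\<close> of order \<open>ln k\<close> suffices, so
  \<open>(1 + real k * \<theta>) ^ l\<close> is subexponential in \<open>k\<close>. In the exponent,
  the first factor exceeds \<open>\<delta> / 2 * \<rho>\<close> per letter by at most
  \<open>\<delta>\<^sup>2 / 4\<close>, whereas the right-hand side has a surplus of
  \<open>\<delta>\<^sup>2 / 2\<close>.\<close>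

lemma exists_block_size:
  fixes \<delta> :: real
  assumes "0 < \<delta>" "\<delta> \<le> 1" "2 \<le> r" "r \<le> s"
  defines "\<theta> \<equiv> exp (\<delta> / 2)"
  shows "\<exists>k l. 0 < k \<and> real ((1 + k * M) ^ d) < (real r / (real r - 1)) ^ l \<and>
    (real s + (\<theta> - 1) * (real r - 1)) ^ k * (1 + real k * \<theta>) ^ l
      < real s ^ k * exp (\<delta> / 2 * (((real r - 1) / real s + \<delta>) * real k))"
proof -
  define \<alpha> where "\<alpha> = real r / (real r - 1)"
  define \<rho> where "\<rho> = (real r - 1) / real s"
  have \<alpha>: "1 < \<alpha>"
    using assms by (simp add: \<alpha>_def)
  then have la: "0 < ln \<alpha>" by simp
  have \<rho>: "0 \<le> \<rho>" "\<rho> \<le> 1"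
    using assms by (auto simp: \<rho>_def)
  have \<theta>: "0 < \<theta>" "1 \<le> \<theta>"
    using assms by auto
  \<comment> \<open>The numerator grows at most like the square of \<open>ln k\<close>. For
    \<open>M = 0\<close> the inner logarithm vanishes, so the asymptotics differ.\<close>
  have "((\<lambda>k. (real d * ln (1 + k * real M) / ln \<alpha> + 2) * ln (1 + k * \<theta>) / k) \<longlongrightarrow> 0) at_top"
  proof (cases "M = 0")
    case True
    show ?thesis unfolding True using \<theta>(1) la by simp real_asymp
  next
    case False
    then have "0 < real M" by simp
    then show ?thesis using \<theta>(1) la by real_asymp
  qed
  then have "((\<lambda>k::nat. (real d * ln (1 + real k * real M) / ln \<alpha> + 2) * ln (1 + real k * \<theta>) / real k) \<longlongrightarrow> 0) at_top"
    using filterlim_compose filterlim_real_sequentially by blast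
  then have "\<forall>\<^sub>F k::nat in at_top. (real d * ln (1 + real k * real M) / ln \<alpha> + 2) * ln (1 + real k * \<theta>) / real k < \<delta>\<^sup>2 / 4"
    using assms by (intro order_tendstoD(2)) auto
  then have "\<forall>\<^sub>F k::nat in at_top. 0 < k \<and> (real d * ln (1 + real k * real M) / ln \<alpha> + 2) * ln (1 + real k * \<theta>) / real k < \<delta>\<^sup>2 / 4"
    using eventually_gt_at_top[of 0] by eventually_elim auto
  then obtain k :: nat where k: "0 < k" "(real d * ln (1 + real k * real M) / ln \<alpha> + 2) * ln (1 + real k * \<theta>) / real k < \<delta>\<^sup>2 / 4"
    using eventually_happens' sequentially_bot by blast
  \<comment> \<open>\<open>z\<close> solves \<open>exp (z * ln \<alpha>) = (1 + k * M) ^ d\<close>.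
    Rounding up and adding one makes the comparison strict and keeps \<open>l\<close> at most
    \<open>z + 2\<close>.\<close>
  define z where "z = real d * ln (1 + real k * real M) / ln \<alpha>"
  have z: "0 \<le> z"
    using la by (simp add: z_def)
  define l where "l = nat \<lceil>z\<rceil> + 1"
  have l: "z < real l" "real l \<le> z + 2"
    using z unfolding l_def by linarith+
  have "real ((1 + k * M) ^ d) = exp (z * ln \<alpha>)"
  proof -
    have "z * ln \<alpha> = real d * ln (1 + real k * real M)"
      using la by (simp add: z_def)
    moreover have "0 < 1 + real k * real M"
      by (simp add: add_pos_nonneg)
    ultimately show ?thesis
      by (simp add: exp_of_nat_mult)
  qed
  also have "\<dots> < exp (real l * ln \<alpha>)"
    using l la by simp
  also have "\<dots> = \<alpha> ^ l"
    using \<alpha> by (simp add: exp_of_nat_mult)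
  finally have 1: "real ((1 + k * M) ^ d) < \<alpha> ^ l" .
  \<comment> \<open>The quadratic error comes from \<open>exp x \<le> 1 + x + x\<^sup>2\<close> at
    \<open>x = \<delta> / 2\<close>; then \<open>\<rho> \<le> 1\<close> removes
    \<open>\<rho>\<close> from it.\<close>
  have "\<theta> - 1 \<le> \<delta> / 2 + (\<delta> / 2)\<^sup>2"
    using exp_bound[of "\<delta> / 2"] assms by simp
  then have "(\<theta> - 1) * \<rho> \<le> (\<delta> / 2 + (\<delta> / 2)\<^sup>2) * \<rho>"
    using \<rho> by (intro mult_right_mono)
  also have "\<dots> \<le> \<delta> / 2 * \<rho> + \<delta>\<^sup>2 / 4"
    using \<rho> mult_left_mono[of \<rho> 1 "\<delta>\<^sup>2 / 4"] by (simp add: algebra_simps power_divide)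
  finally have q: "1 + (\<theta> - 1) * \<rho> \<le> exp (\<delta> / 2 * \<rho> + \<delta>\<^sup>2 / 4)"
    using exp_ge_add_one_self order_trans by (smt (verit))
  have "real s + (\<theta> - 1) * (real r - 1) = real s * (1 + (\<theta> - 1) * \<rho>)"
    using assms by (simp add: \<rho>_def field_simps)
  then have "(real s + (\<theta> - 1) * (real r - 1)) ^ k = real s ^ k * (1 + (\<theta> - 1) * \<rho>) ^ k"
    by (simp add: power_mult_distrib)
  also have "\<dots> \<le> real s ^ k * exp (\<delta> / 2 * \<rho> + \<delta>\<^sup>2 / 4) ^ k"
    using q \<theta> \<rho> by (intro mult_left_mono power_mono) auto
  finally have q: "(real s + (\<theta> - 1) * (real r - 1)) ^ k \<le> real s ^ k * exp (real k * (\<delta> / 2 * \<rho> + \<delta>\<^sup>2 / 4))"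
    by (simp add: exp_of_nat_mult)
  have pos: "1 \<le> 1 + real k * \<theta>"
    using \<theta> by simp
  have "real l * ln (1 + real k * \<theta>) \<le> (z + 2) * ln (1 + real k * \<theta>)"
    using l pos by (intro mult_right_mono) auto
  also have "\<dots> < real k * (\<delta>\<^sup>2 / 4)"
    using k by (simp add: z_def field_simps)
  finally have "exp (real l * ln (1 + real k * \<theta>)) < exp (real k * (\<delta>\<^sup>2 / 4))"
    by simp
  moreover have "exp (real l * ln (1 + real k * \<theta>)) = (1 + real k * \<theta>) ^ l"
    using pos by (simp add: exp_of_nat_mult)
  ultimately have p: "(1 + real k * \<theta>) ^ l < exp (real k * (\<delta>\<^sup>2 / 4))"
    by simp
  have "(real s + (\<theta> - 1) * (real r - 1)) ^ k * (1 + real k * \<theta>) ^ l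
      \<le> real s ^ k * exp (real k * (\<delta> / 2 * \<rho> + \<delta>\<^sup>2 / 4)) * (1 + real k * \<theta>) ^ l"
    using q pos by (intro mult_right_mono) auto
  also have "\<dots> < real s ^ k * exp (real k * (\<delta> / 2 * \<rho> + \<delta>\<^sup>2 / 4)) * exp (real k * (\<delta>\<^sup>2 / 4))"
    using p assms by (intro mult_strict_left_mono) auto
  also have "\<dots> = real s ^ k * exp (\<delta> / 2 * ((\<rho> + \<delta>) * real k))"
    by (simp add: mult.assoc exp_add[symmetric]) (simp add: algebra_simps power2_eq_square)
  finally show ?thesis
    using 1 k unfolding \<alpha>_def \<rho>_def by blast
qed

text \<open>Convexity through the tangent of \<open>exp\<close> at \<open>\<tau> * a\<close>: summed
  over \<open>W\<close>, its linear term is nonnegative.\<close>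

lemma sum_exp_ge:
  fixes x :: "'a \<Rightarrow> real"
  assumes "finite W" "0 \<le> \<tau>" "real (card W) * a \<le> sum x W"
  shows "real (card W) * exp (\<tau> * a) \<le> (\<Sum>v\<in>W. exp (\<tau> * x v))"
proof -
  have "exp (\<tau> * a) * (1 + \<tau> * (y - a)) \<le> exp (\<tau> * y)" for y
  proof -
    have "exp (\<tau> * a) * (1 + \<tau> * (y - a)) \<le> exp (\<tau> * a) * exp (\<tau> * (y - a))"
      by (intro mult_left_mono exp_ge_add_one_self) auto
    then show ?thesis
      by (simp add: exp_add[symmetric] algebra_simps)
  qed
  then have "(\<Sum>v\<in>W. exp (\<tau> * a) * (1 + \<tau> * (x v - a))) \<le> (\<Sum>v\<in>W. exp (\<tau> * x v))"
    by (rule sum_mono)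
  moreover have "(\<Sum>v\<in>W. exp (\<tau> * a) * (1 + \<tau> * (x v - a)))
      = exp (\<tau> * a) * (real (card W) + \<tau> * (sum x W - real (card W) * a))"
    by (simp add: sum_distrib_left[symmetric] sum.distrib sum_subtractf)
  moreover have "exp (\<tau> * a) * (real (card W) + 0) \<le> exp (\<tau> * a) * (real (card W) + \<tau> * (sum x W - real (card W) * a))"
    using assms by (intro mult_left_mono add_left_mono) auto
  ultimately show ?thesis
    by (simp only: add_0_right mult.commute)
qed

section \<open>Large agreement and patterns with many marks\<close>

definition words :: "nat \<Rightarrow> nat \<Rightarrow> nat list set" where
  "words s k = {v. set v \<subseteq> {..<s} \<and> length v = k}"

lemma finite_words: "finite (words s k)"
  unfolding words_def by (rule finite_lists_length_eq) simp

lemma card_words: "card (words s k) = s ^ k"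
  unfolding words_def by (simp add: card_lists_length_eq)

text \<open>\<open>g i v\<close> is the new color of the cell in row \<open>i\<close> and column
  \<open>v\<close>, and \<open>k\<close> is fixed before \<open>g\<close>. Large agreement forces a
  large exponential weight, hence more shattered patterns than there are patterns with at most
  \<open>d\<close> marks.\<close>

lemma agreement_shatters:
  fixes \<delta> :: real
  assumes \<delta>: "0 < \<delta>" "\<delta> \<le> 1" and r: "2 \<le> r" "r \<le> s"
  defines "\<T> \<equiv> {T. T \<subseteq> {..<s} \<and> card T = r}"
  shows "\<exists>k>0. \<forall>g :: nat \<Rightarrow> nat list \<Rightarrow> nat.
    ((real r - 1) / real s + \<delta>) * (real k * real s ^ k)
        \<le> real (card {(i, v). i < k \<and> v \<in> words s k \<and> g i v = v ! i}) \<longrightarrow>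
    (\<exists>t. set t \<subseteq> insert None (Some ` \<T>) \<and> length t = k \<and> d < nsome t \<and>
      shatters ((\<lambda>v. map (\<lambda>i. if g i v = v ! i then Some (v ! i) else None) [0..<k]) ` words s k) t)"
proof -
  define a where "a = (real r - 1) / real s + \<delta>"
  define \<theta> where "\<theta> = exp (\<delta> / 2)"
  have fin: "finite \<T>"
    unfolding \<T>_def by (rule finite_subset[of _ "Pow {..<s}"]) auto
  obtain k l where k: "0 < k" and kl: "real ((1 + k * card \<T>) ^ d) < (real r / (real r - 1)) ^ l"
    and bound: "(real s + (\<theta> - 1) * (real r - 1)) ^ k * (1 + real k * \<theta>) ^ l
      < real s ^ k * exp (\<delta> / 2 * (a * real k))"
    using exists_block_size[OF \<delta> r] unfolding a_def \<theta>_def by blast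
  show ?thesis
  proof (rule exI[of _ k], intro conjI allI impI k)
    fix g :: "nat \<Rightarrow> nat list \<Rightarrow> nat"
    define h where "h v = map (\<lambda>i. if g i v = v ! i then Some (v ! i) else None) [0..<k]" for v
    assume "((real r - 1) / real s + \<delta>) * (real k * real s ^ k)
        \<le> real (card {(i, v). i < k \<and> v \<in> words s k \<and> g i v = v ! i})"
    then have agree: "real (card (words s k)) * (a * real k) \<le> real (card {(i, v). i < k \<and> v \<in> words s k \<and> g i v = v ! i})"
      by (simp add: a_def card_words mult_ac)
    have "{(i, v). i < k \<and> v \<in> words s k \<and> g i v = v ! i} = prod.swap ` (SIGMA v:words s k. {i. i < k \<and> g i v = v ! i})"
      by auto
    then have "card {(i, v). i < k \<and> v \<in> words s k \<and> g i v = v ! i} = card (SIGMA v:words s k. {i. i < k \<and> g i v = v ! i})"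
      by (simp add: card_image)
    also have "\<dots> = (\<Sum>v\<in>words s k. card {i. i < k \<and> g i v = v ! i})"
      by (intro card_SigmaI finite_words) auto
    also have "\<dots> = (\<Sum>v\<in>words s k. nsome (h v))"
    proof (intro sum.cong refl)
      fix v
      have "{i. i < k \<and> g i v = v ! i} = {i. i < length (h v) \<and> h v ! i \<noteq> None}"
        by (auto simp: h_def split: if_splits)
      then show "card {i. i < k \<and> g i v = v ! i} = nsome (h v)"
        by (simp add: nsome_def length_filter_conv_card)
    qed
    finally have "real (card (words s k)) * (a * real k) \<le> (\<Sum>v\<in>words s k. real (nsome (h v)))"
      using agree by simp
    then have "real (card (words s k)) * exp (\<delta> / 2 * (a * real k)) \<le> (\<Sum>v\<in>words s k. exp (\<delta> / 2 * real (nsome (h v))))"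
      using \<delta> by (intro sum_exp_ge finite_words) auto
    also have "\<dots> = (\<Sum>v\<in>words s k. \<theta> ^ nsome (h v))"
      by (simp add: \<theta>_def exp_of_nat_mult[symmetric] mult.commute)
    finally have lower: "real s ^ k * exp (\<delta> / 2 * (a * real k)) \<le> (\<Sum>v\<in>words s k. \<theta> ^ nsome (h v))"
      by (simp add: card_words)
    \<comment> \<open>Otherwise \<open>weighted_count_bound\<close> puts the total weight strictly
      below \<open>lower\<close>.\<close>
    have "real ((1 + k * card \<T>) ^ d) < real (card (shattered \<T> k (h ` words s k)))"
    proof (rule ccontr)
      assume "\<not> ?thesis"
      then have small: "real (card (shattered \<T> k (h ` words s k))) < (real r / (real r - 1)) ^ l"
        using kl by linarith
      have "(\<Sum>v\<in>words s k. \<theta> ^ nsome (h v)) \<le> (real s + (\<theta> - 1) * (real r - 1)) ^ k * (1 + real k * \<theta>) ^ l"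
      proof (rule weighted_count_bound[OF _ _ r(1)])
        show "words s k \<subseteq> {v. set v \<subseteq> {..<s} \<and> length v = k}"
          by (simp add: words_def)
        show "list_all2 (\<lambda>x y. y = None \<or> y = Some x) v (h v)" if "v \<in> words s k" for v
          using that by (auto simp: h_def words_def list_all2_conv_all_nth)
        show "1 \<le> \<theta>"
          using \<delta> by (simp add: \<theta>_def)
      qed (use small \<T>_def in auto)
      then show False
        using bound lower by linarith
    qed
    then have "(1 + k * card \<T>) ^ d < card (shattered \<T> k (h ` words s k))"
      by (simp only: of_nat_less_iff)
    then have "\<not> shattered \<T> k (h ` words s k) \<subseteq> {t. set t \<subseteq> insert None (Some ` \<T>) \<and> length t = k \<and> nsome t \<le> d}"
      using card_few_somes[OF fin, of k d] card_mono[OF finite_few_somes[OF fin]] by (meson le_trans not_le)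
    then obtain t where "t \<in> shattered \<T> k (h ` words s k)"
      "t \<notin> {t. set t \<subseteq> insert None (Some ` \<T>) \<and> length t = k \<and> nsome t \<le> d}"
      by blast
    then show "\<exists>t. set t \<subseteq> insert None (Some ` \<T>) \<and> length t = k \<and> d < nsome t \<and>
      shatters ((\<lambda>v. map (\<lambda>i. if g i v = v ! i then Some (v ! i) else None) [0..<k]) ` words s k) t"
      unfolding shattered_def h_def by (intro exI[of _ t]) auto
  qed
qed

text \<open>Pigeonhole principle: the marks are spread over \<open>card \<T>\<close> sets, so one
  set occurs often.\<close>

lemma popular_entry:
  assumes "set t \<subseteq> insert None (Some ` \<T>)" "finite \<T>" "card \<T> * b < nsome t"
  shows "\<exists>T\<in>\<T>. b < card {i. i < length t \<and> t ! i = Some T}"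
proof (rule ccontr)
  assume "\<not> ?thesis"
  then have le: "card {i. i < length t \<and> t ! i = Some T} \<le> b" if "T \<in> \<T>" for T
    using that by auto
  have "{i. i < length t \<and> t ! i \<noteq> None} \<subseteq> (\<Union>T\<in>\<T>. {i. i < length t \<and> t ! i = Some T})"
  proof
    fix i assume i: "i \<in> {i. i < length t \<and> t ! i \<noteq> None}"
    then have "t ! i \<in> insert None (Some ` \<T>)"
      using i assms(1) nth_mem[of i t] by blast
    then show "i \<in> (\<Union>T\<in>\<T>. {i. i < length t \<and> t ! i = Some T})"
      using i by auto
  qed
  then have "nsome t \<le> card (\<Union>T\<in>\<T>. {i. i < length t \<and> t ! i = Some T})"
    unfolding nsome_def length_filter_conv_card using assms(2) by (intro card_mono) auto
  also have "\<dots> \<le> (\<Sum>T\<in>\<T>. card {i. i < length t \<and> t ! i = Some T})"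
    by (rule card_UN_le[OF assms(2)])
  also have "\<dots> \<le> card \<T> * b"
    using sum_bounded_above[of \<T> "\<lambda>T. card {i. i < length t \<and> t ! i = Some T}" b] le by simp
  finally show False
    using assms(3) by simp
qed

text \<open>More than \<open>card \<T> * (m' + n')\<close> marks give more than
  \<open>m' + n'\<close> rows marked with one \<open>r\<close>-set \<open>T\<close>. Every
  assignment of colors from \<open>T\<close> to these rows occurs in some column, on cells that were
  not recolored.\<close>

lemma block_embedding:
  fixes \<delta> :: real
  assumes \<delta>: "0 < \<delta>" "\<delta> \<le> 1" and r: "2 \<le> r" "r \<le> s"
    and pat: "edge_pattern (complete_bipartite m' n') r \<A>"
  shows "\<exists>k>0. \<forall>g :: nat \<Rightarrow> nat list \<Rightarrow> nat.
    ((real r - 1) / real s + \<delta>) * (real k * real s ^ k)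
        \<le> real (card {(i, v). i < k \<and> v \<in> words s k \<and> g i v = v ! i}) \<longrightarrow>
    (\<exists>\<rho> \<gamma> \<beta>. inj_on \<rho> {..<m'} \<and> \<rho> ` {..<m'} \<subseteq> {..<k} \<and> inj_on \<gamma> {..<n'} \<and> \<gamma> ` {..<n'} \<subseteq> words s k \<and>
      inj_on \<beta> \<A> \<and>
      (\<forall>i<m'. \<forall>j<n'. \<forall>A\<in>\<A>. {Inl i, Inr j} \<in> A \<longrightarrow> g (\<rho> i) (\<gamma> j) = \<beta> A))"
proof -
  define \<T> where "\<T> = {T. T \<subseteq> {..<s} \<and> card T = r}"
  have fin: "finite \<T>"
    unfolding \<T>_def by (rule finite_subset[of _ "Pow {..<s}"]) auto
  have part: "partition_on (edges (complete_bipartite m' n')) \<A>" and finA: "finite \<A>" and cardA: "card \<A> = r"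
    using pat by (auto simp: edge_pattern_def)
  obtain k where k: "0 < k" and sh: "\<And>g :: nat \<Rightarrow> nat list \<Rightarrow> nat.
    ((real r - 1) / real s + \<delta>) * (real k * real s ^ k)
        \<le> real (card {(i, v). i < k \<and> v \<in> words s k \<and> g i v = v ! i}) \<Longrightarrow>
    \<exists>t. set t \<subseteq> insert None (Some ` \<T>) \<and> length t = k \<and> card \<T> * (m' + n') < nsome t \<and>
      shatters ((\<lambda>v. map (\<lambda>i. if g i v = v ! i then Some (v ! i) else None) [0..<k]) ` words s k) t"
    using agreement_shatters[OF \<delta> r, of "card \<T> * (m' + n')"] unfolding \<T>_def by blast
  show ?thesis
  proof (rule exI[of _ k], intro conjI allI impI k)
    fix g :: "nat \<Rightarrow> nat list \<Rightarrow> nat"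
    define h where "h v = map (\<lambda>i. if g i v = v ! i then Some (v ! i) else None) [0..<k]" for v
    assume "((real r - 1) / real s + \<delta>) * (real k * real s ^ k)
        \<le> real (card {(i, v). i < k \<and> v \<in> words s k \<and> g i v = v ! i})"
    from sh[OF this] obtain t where t: "set t \<subseteq> insert None (Some ` \<T>)" "length t = k"
      "card \<T> * (m' + n') < nsome t" "shatters (h ` words s k) t"
      unfolding h_def by blast
    obtain T where T: "T \<in> \<T>" "m' + n' < card {i. i < k \<and> t ! i = Some T}"
      using popular_entry[OF t(1) fin t(3)] t(2) by auto
    define P where "P = {i. i < k \<and> t ! i = Some T}"
    \<comment> \<open>The rows \<open>\<pi> i\<close> with \<open>i < m'\<close> will carry the
      pattern; the row \<open>\<pi> (m' + j)\<close> marks column \<open>j\<close>.\<close>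
    obtain \<pi> where \<pi>: "\<pi> ` {..<m' + n'} \<subseteq> P" "inj_on \<pi> {..<m' + n'}"
      using card_le_inj[of "{..<m' + n'}" P] T(2) by (auto simp: P_def)
    have Tr: "card T = r" "finite T"
      using T(1) r card.infinite[of T] by (auto simp: \<T>_def)
    obtain \<beta> where \<beta>: "\<beta> ` \<A> \<subseteq> T" "inj_on \<beta> \<A>"
      using card_le_inj[OF finA Tr(2)] cardA Tr by auto
    obtain x0 x1 where x: "x0 \<in> T" "x1 \<in> T" "x0 \<noteq> x1"
      using Tr r by (metis card_le_Suc0_iff_eq not_less_eq_eq numeral_2_eq_2)
    define cl where "cl i j = (SOME A. A \<in> \<A> \<and> {Inl i, Inr j} \<in> A)" for i j
    have cl: "cl i j = A" if "A \<in> \<A>" "{Inl i, Inr j} \<in> A" for i j A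
    proof -
      have uniq: "B = A" if "B \<in> \<A>" "{Inl i, Inr j} \<in> B" for B
        using disjointD[OF partition_onD2[OF part] \<open>B \<in> \<A>\<close> \<open>A \<in> \<A>\<close>] that \<open>{Inl i, Inr j} \<in> A\<close> by blast
      show ?thesis
        unfolding cl_def by (rule some_equality) (use uniq that in blast)+
    qed
    have cl_in: "cl i j \<in> \<A>" if "i < m'" "j < n'" for i j
    proof -
      have "{Inl i, Inr j} \<in> \<Union>\<A>"
        using that partition_onD1[OF part, symmetric] by simp
      then obtain A where "A \<in> \<A>" "{Inl i, Inr j} \<in> A"
        by blast
      then show ?thesis
        using cl[of A i j] by simp
    qed
    \<comment> \<open>The word wanted for column \<open>j\<close>: class colors on the pattern rows,
      \<open>x0\<close> on the marker row of \<open>j\<close>, \<open>x1\<close> on the other rows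
      of \<open>P\<close>, and elsewhere any letter of the set marked there.\<close>
    define w where "w j i = (if i \<in> \<pi> ` {..<m'} then \<beta> (cl (inv_into {..<m' + n'} \<pi> i) j)
      else if i = \<pi> (m' + j) then x0 else if i \<in> P then x1 else SOME x. x \<in> the (t ! i))" for j i
    have w_row: "w j (\<pi> i) = \<beta> (cl i j)" if "i < m'" for i j
      using that \<pi>(2) by (simp add: w_def inv_into_f_f)
    have w_mark: "w j (\<pi> (m' + j')) = (if j' = j then x0 else x1)" if "j < n'" "j' < n'" for j j'
    proof -
      have "\<pi> (m' + j') \<notin> \<pi> ` {..<m'}"
        using inj_onD[OF \<pi>(2), of "m' + j'"] that by fastforce
      moreover have "\<pi> (m' + j') \<in> P"
        using \<pi>(1) that by auto
      moreover have "\<pi> (m' + j') = \<pi> (m' + j) \<longleftrightarrow> j' = j"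
        using inj_on_eq_iff[OF \<pi>(2), of "m' + j'" "m' + j"] that by simp
      ultimately show ?thesis
        by (simp add: w_def)
    qed
    have w_in: "w j i \<in> T'" if "j < n'" "i < length t" "t ! i = Some T'" for j i T'
    proof (cases "i \<in> P")
      case True
      then have "T' = T"
        using that by (simp add: P_def)
      moreover have "w j i \<in> T"
      proof (cases "i \<in> \<pi> ` {..<m'}")
        case True
        then obtain i' where "i = \<pi> i'" "i' < m'" by auto
        then show ?thesis
          using w_row cl_in[OF \<open>i' < m'\<close> \<open>j < n'\<close>] \<beta>(1) by auto
      qed (use True x in \<open>auto simp: w_def\<close>)
      ultimately show ?thesis by simp
    next
      case False
      have "t ! i \<in> insert None (Some ` \<T>)"
        using t(1) that(2) nth_mem[of i t] by blast
      then have "T' \<in> \<T>"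
        using that by auto
      then have "T' \<noteq> {}"
        using r by (auto simp: \<T>_def)
      moreover have "\<pi> (m' + j) \<in> P" "\<pi> ` {..<m'} \<subseteq> P"
        using \<pi>(1) that by auto
      ultimately show ?thesis
        using False that by (auto simp: w_def some_in_eq)
    qed
    \<comment> \<open>An entry \<open>Some\<close> of \<open>h v\<close> records an unchanged cell,
      so the new color and the original letter both equal the prescribed one.\<close>
    have "\<exists>v. v \<in> words s k \<and> (\<forall>i<k. t ! i \<noteq> None \<longrightarrow> g i v = w j i \<and> v ! i = w j i)" if j: "j < n'" for j
    proof -
      have "length u = length t" if "u \<in> h ` words s k" for u
        using that t(2) by (auto simp: h_def)
      then obtain u where u: "u \<in> h ` words s k" "\<forall>i<length t. t ! i \<noteq> None \<longrightarrow> u ! i = Some (w j i)"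
        using shatters_realizes[OF t(4), of "w j"] w_in[OF j] by blast
      then obtain v where v: "v \<in> words s k" "u = h v"
        by auto
      have "g i v = w j i \<and> v ! i = w j i" if "i < k" "t ! i \<noteq> None" for i
        using u(2) that v(2) t(2) by (auto simp: h_def split: if_splits)
      then show ?thesis
        using v(1) by blast
    qed
    then obtain \<gamma> where \<gamma>: "\<And>j. j < n' \<Longrightarrow> \<gamma> j \<in> words s k"
      "\<And>j i. j < n' \<Longrightarrow> i < k \<Longrightarrow> t ! i \<noteq> None \<Longrightarrow> g i (\<gamma> j) = w j i \<and> \<gamma> j ! i = w j i"
      by metis
    have Pk: "\<pi> i < k" "t ! (\<pi> i) \<noteq> None" if "i < m' + n'" for i
      using \<pi>(1) that by (auto simp: P_def)
    \<comment> \<open>Two columns of the pattern may be colored alike; the marker row of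
      \<open>j\<close> still separates the words, showing \<open>x0\<close> for \<open>j\<close> and
      \<open>x1\<close> for the others.\<close>
    have "inj_on \<gamma> {..<n'}"
    proof (rule inj_onI, rule ccontr)
      fix j j' assume j: "j \<in> {..<n'}" "j' \<in> {..<n'}" "\<gamma> j = \<gamma> j'" "j \<noteq> j'"
      then have "w j (\<pi> (m' + j)) = w j' (\<pi> (m' + j))"
        using \<gamma>(2)[of j "\<pi> (m' + j)"] \<gamma>(2)[of j' "\<pi> (m' + j)"] Pk[of "m' + j"] by simp
      then show False
        using j x w_mark by simp
    qed
    moreover have "g (\<pi> i) (\<gamma> j) = \<beta> A" if "i < m'" "j < n'" "A \<in> \<A>" "{Inl i, Inr j} \<in> A" for i j A
      using \<gamma>(2)[of j "\<pi> i"] Pk[of i] w_row cl that by simp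
    moreover have "inj_on \<pi> {..<m'}"
      using \<pi>(2) by (rule inj_on_subset) auto
    moreover have "\<pi> ` {..<m'} \<subseteq> {..<k}" "\<gamma> ` {..<n'} \<subseteq> words s k"
      using Pk(1) \<gamma>(1) by auto
    ultimately show "\<exists>\<rho> \<gamma> \<beta>. inj_on \<rho> {..<m'} \<and> \<rho> ` {..<m'} \<subseteq> {..<k} \<and> inj_on \<gamma> {..<n'} \<and> \<gamma> ` {..<n'} \<subseteq> words s k \<and>
      inj_on \<beta> \<A> \<and>
      (\<forall>i<m'. \<forall>j<n'. \<forall>A\<in>\<A>. {Inl i, Inr j} \<in> A \<longrightarrow> g (\<rho> i) (\<gamma> j) = \<beta> A)"
      using \<beta>(2) by blast
  qed
qed

section \<open>The periodic coloring\<close>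

text \<open>Cells outside the complete \<open>p\<close> by \<open>q\<close> blocks lie in fewer than
  \<open>p\<close> last rows or fewer than \<open>q\<close> last columns.\<close>

lemma card_periodic_agreement:
  fixes a :: real and p q m n :: nat
  assumes p: "0 < p" and q: "0 < q" and a: "0 \<le> a"
    and block: "\<And>I J. I < m div p \<Longrightarrow> J < n div q \<Longrightarrow>
      real (card {(i, j) \<in> R. i div p = I \<and> j div q = J}) \<le> a * (real p * real q)"
    and R: "R \<subseteq> {..<m} \<times> {..<n}"
  shows "real (card R) \<le> a * (real m * real n) + real p * real n + real q * real m"
proof -
  define M N where "M = m div p" and "N = n div q"
  define B where "B = (\<lambda>(I, J). {(i, j) \<in> R. i div p = I \<and> j div q = J})"
  have finR: "finite R"
    using R finite_subset by blast
  have rest: "x * (y div x) \<le> i" if "y div x \<le> i div x" for i x y :: nat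
    by (meson div_times_less_eq_dividend dual_order.trans mult_le_mono2 that times_div_less_eq_dividend)
  have "R \<subseteq> (\<Union>x\<in>{..<M} \<times> {..<N}. B x) \<union> {p * M..<m} \<times> {..<n} \<union> {..<m} \<times> {q * N..<n}"
  proof
    fix x assume "x \<in> R"
    moreover obtain i j where "x = (i, j)"
      by (cases x)
    ultimately have ij: "x = (i, j)" "(i, j) \<in> R" "i < m" "j < n"
      using R by auto
    show "x \<in> (\<Union>x\<in>{..<M} \<times> {..<N}. B x) \<union> {p * M..<m} \<times> {..<n} \<union> {..<m} \<times> {q * N..<n}"
    proof (cases "i div p < M \<and> j div q < N")
      case True
      then have "x \<in> B (i div p, j div q)" "(i div p, j div q) \<in> {..<M} \<times> {..<N}"
        using ij by (auto simp: B_def)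
      then show ?thesis
        by blast
    next
      case False
      then have "p * M \<le> i \<or> q * N \<le> j"
        using rest unfolding M_def N_def not_less de_Morgan_conj by blast
      then show ?thesis
        using ij by auto
    qed
  qed
  then have "card R \<le> card ((\<Union>x\<in>{..<M} \<times> {..<N}. B x) \<union> {p * M..<m} \<times> {..<n} \<union> {..<m} \<times> {q * N..<n})"
    using finR by (intro card_mono) (auto simp: B_def intro: finite_subset[OF _ finR])
  also have "\<dots> \<le> card (\<Union>x\<in>{..<M} \<times> {..<N}. B x) + card ({p * M..<m} \<times> {..<n}) + card ({..<m} \<times> {q * N..<n})"
    by (meson add_le_mono1 card_Un_le le_trans)
  also have "\<dots> = card (\<Union>x\<in>{..<M} \<times> {..<N}. B x) + (m - p * M) * n + m * (n - q * N)"
    by (simp add: card_cartesian_product)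
  also have "\<dots> \<le> (\<Sum>x\<in>{..<M} \<times> {..<N}. card (B x)) + p * n + m * q"
  proof (intro add_mono mult_mono card_UN_le)
    show "m - p * M \<le> p" "n - q * N \<le> q"
      using p q by (simp_all add: M_def N_def minus_mult_div_eq_mod less_imp_le)
  qed auto
  finally have "real (card R) \<le> real ((\<Sum>x\<in>{..<M} \<times> {..<N}. card (B x)) + p * n + m * q)"
    by (rule of_nat_mono)
  also have "\<dots> = (\<Sum>x\<in>{..<M} \<times> {..<N}. real (card (B x))) + real p * real n + real q * real m"
    by simp
  also have "(\<Sum>x\<in>{..<M} \<times> {..<N}. real (card (B x))) \<le> real (card ({..<M} \<times> {..<N})) * (a * (real p * real q))"
    using block by (intro sum_bounded_above) (auto simp: B_def M_def N_def)
  also have "\<dots> = a * (real (M * p) * real (N * q))"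
    by (simp add: card_cartesian_product)
  also have "\<dots> \<le> a * (real m * real n)"
    using a by (intro mult_left_mono mult_mono of_nat_mono) (auto simp: M_def N_def)
  finally show ?thesis
    by simp
qed

text \<open>A recoloring that avoids the pattern agrees little on each complete block; only the
  border escapes this bound. The condition \<open>q \<le> n\<close> puts the constant words among
  the columns, so all \<open>s\<close> colors occur.\<close>

lemma exists_robust_coloring:
  fixes \<delta> :: real
  assumes \<delta>: "0 < \<delta>" "\<delta> \<le> 1" and r: "2 \<le> r" "r \<le> s"
    and pat: "edge_pattern (complete_bipartite m' n') r \<A>"
  shows "\<exists>p>0. \<exists>q>0. \<forall>m n. 0 < m \<longrightarrow> q \<le> n \<longrightarrow>
    (\<exists>c. card (c ` edges (complete_bipartite m n)) = s \<and>
      real m * real n - (((real r - 1) / real s + \<delta>) * (real m * real n) + real p * real n + real q * real m)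
        \<le> real (F_col m n c (complete_bipartite m' n') \<A>))"
proof -
  define a where "a = (real r - 1) / real s + \<delta>"
  have a: "0 \<le> a"
    using r \<delta> by (simp add: a_def)
  obtain p where p: "0 < p" and emb: "\<And>g :: nat \<Rightarrow> nat list \<Rightarrow> nat.
    a * (real p * real s ^ p)
        \<le> real (card {(i, v). i < p \<and> v \<in> words s p \<and> g i v = v ! i}) \<Longrightarrow>
    \<exists>\<rho> \<gamma> \<beta>. inj_on \<rho> {..<m'} \<and> \<rho> ` {..<m'} \<subseteq> {..<p} \<and> inj_on \<gamma> {..<n'} \<and> \<gamma> ` {..<n'} \<subseteq> words s p \<and>
      inj_on \<beta> \<A> \<and>
      (\<forall>i<m'. \<forall>j<n'. \<forall>A\<in>\<A>. {Inl i, Inr j} \<in> A \<longrightarrow> g (\<rho> i) (\<gamma> j) = \<beta> A)"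
    using block_embedding[OF \<delta> r pat] unfolding a_def by blast
  define q where "q = s ^ p"
  have q: "0 < q"
    using r by (simp add: q_def)
  obtain e where e: "bij_betw e {..<q} (words s p)"
    using ex_bij_betw_nat_finite[OF finite_words, of s p] by (auto simp: card_words q_def atLeast0LessThan)
  define e' where "e' = inv_into {..<q} e"
  have e': "bij_betw e' (words s p) {..<q}"
    unfolding e'_def by (rule bij_betw_inv_into[OF e])
  have e'e: "e' (e j) = j" if "j < q" for j
    using e that by (auto simp: e'_def bij_betw_def)
  have ee': "e (e' v) = v" if "v \<in> words s p" for v
    using e that by (auto simp: e'_def bij_betw_def f_inv_into_f)
  have e_in: "e j \<in> words s p" if "j < q" for j
    using e that by (auto simp: bij_betw_def)
  \<comment> \<open>Column \<open>j\<close> repeats the word numbered \<open>j mod q\<close> down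
    the rows with period \<open>p\<close>.\<close>
  obtain c where c: "\<And>i j. c {Inl i, Inr j} = e (j mod q) ! (i mod p)"
    using edge_coloring_of_grid[of "\<lambda>i j. e (j mod q) ! (i mod p)"] by blast
  show ?thesis
  proof (rule exI[of _ p], intro conjI p, rule exI[of _ q], intro conjI q allI impI, rule exI[of _ c], intro conjI)
    fix m n :: nat assume m: "0 < m" and n: "q \<le> n"
    let ?G = "complete_bipartite m n" and ?G' = "complete_bipartite m' n'"
    have "c ` edges ?G = {..<s}"
    proof
      have "e (j mod q) ! (i mod p) < s" for i j
      proof -
        have "e (j mod q) \<in> words s p"
          using e_in q by simp
        then show ?thesis
          using p by (metis (mono_tags) lessThan_iff mem_Collect_eq mod_less_divisor nth_mem subsetD words_def)
      qed
      then show "c ` edges ?G \<subseteq> {..<s}"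
        by (auto simp: complete_bipartite_def c)
      show "{..<s} \<subseteq> c ` edges ?G"
      proof
        fix x assume "x \<in> {..<s}"
        then have v: "replicate p x \<in> words s p"
          by (auto simp: words_def)
        define j where "j = e' (replicate p x)"
        have j: "j < q"
          using e' v by (auto simp: bij_betw_def j_def)
        then have "c {Inl 0, Inr j} = x"
          using p ee'[OF v] by (simp add: c j_def)
        moreover have "{Inl 0, Inr j} \<in> edges ?G"
          using m n j by simp
        ultimately show "x \<in> c ` edges ?G"
          by blast
      qed
    qed
    then show "card (c ` edges ?G) = s"
      by simp
    have "card ((\<lambda>_. 0 :: nat) ` edges ?G) \<le> 1"
      by (simp add: image_constant_conv)
    then have "\<not> contains_subpattern ?G (\<lambda>_. 0 :: nat) ?G' \<A>"
      using r by (intro no_subpattern_if_few_colors[OF pat]) linarith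
    from F_col_attained[OF this, of c] obtain c' where
      F: "card {x \<in> edges ?G. c' x \<noteq> c x} = F_col m n c ?G' \<A>" and avoid: "\<not> contains_subpattern ?G c' ?G' \<A>"
      by blast
    define R where "R = {(i, j). i < m \<and> j < n \<and> c' {Inl i, Inr j} = c {Inl i, Inr j}}"
    have "real (card R) \<le> a * (real m * real n) + real p * real n + real q * real m"
    proof (rule card_periodic_agreement[OF p q a])
      show "R \<subseteq> {..<m} \<times> {..<n}"
        by (auto simp: R_def)
      fix I J assume I: "I < m div p" and J: "J < n div q"
      have rows: "I * p + i < m" if "i < p" for i
      proof -
        have "I * p + i < Suc I * p" using that by simp
        also have "\<dots> \<le> m div p * p" using I by (intro mult_right_mono) auto
        also have "\<dots> \<le> m" by simp
        finally show ?thesis .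
      qed
      have cols: "J * q + j < n" if "j < q" for j
      proof -
        have "J * q + j < Suc J * q" using that by simp
        also have "\<dots> \<le> n div q * q" using J by (intro mult_right_mono) auto
        also have "\<dots> \<le> n" by simp
        finally show ?thesis .
      qed
      \<comment> \<open>The colors of \<open>c'\<close> on the block \<open>(I, J)\<close> in the
        coordinates of \<open>block_embedding\<close>; the original color there is
        \<open>v ! i\<close>.\<close>
      define g where "g i v = c' {Inl (I * p + i), Inr (J * q + e' v)}" for i v
      let ?B = "{(i, j) \<in> R. i div p = I \<and> j div q = J}"
      let ?D = "{(i, v). i < p \<and> v \<in> words s p \<and> g i v = v ! i}"
      have finD: "finite ?D"
        by (rule finite_subset[of _ "{..<p} \<times> words s p"]) (auto simp: finite_words)
      have "card ?B \<le> card ?D"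
      proof (rule card_inj_on_le[where f = "\<lambda>(i, j). (i mod p, e (j mod q))"])
        show "inj_on (\<lambda>(i, j). (i mod p, e (j mod q))) ?B"
        proof (rule inj_onI, clarify)
          fix i j i' j'
          assume eq: "i mod p = i' mod p" "e (j mod q) = e (j' mod q)" "i' div p = i div p" "j' div q = j div q"
          then have "j mod q = j' mod q"
            using e'e q by (metis mod_less_divisor)
          then show "i = i' \<and> j = j'"
            using eq by (metis div_mult_mod_eq)
        qed
        show "(\<lambda>(i, j). (i mod p, e (j mod q))) ` ?B \<subseteq> ?D"
        proof clarify
          fix i j assume "(i, j) \<in> R" "I = i div p" "J = j div q"
          moreover have "e' (e (j mod q)) = j mod q"
            using e'e q by simp
          ultimately show "i mod p < p \<and> e (j mod q) \<in> words s p \<and> g (i mod p) (e (j mod q)) = e (j mod q) ! (i mod p)"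
            using p q e_in by (simp add: g_def R_def c)
        qed
      qed (rule finD)
      \<comment> \<open>Otherwise the block contains the pattern, and shifting by
        \<open>I * p\<close> and \<open>J * q\<close> gives a copy in \<open>?G\<close> under
        \<open>c'\<close>.\<close>
      moreover have "real (card ?D) < a * (real p * real s ^ p)"
      proof (rule ccontr)
        assume "\<not> ?thesis"
        then obtain \<rho> \<gamma> \<beta> where \<rho>: "inj_on \<rho> {..<m'}" "\<rho> ` {..<m'} \<subseteq> {..<p}"
          and \<gamma>: "inj_on \<gamma> {..<n'}" "\<gamma> ` {..<n'} \<subseteq> words s p" and \<beta>: "inj_on \<beta> \<A>"
          and g: "\<And>i j A. i < m' \<Longrightarrow> j < n' \<Longrightarrow> A \<in> \<A> \<Longrightarrow> {Inl i, Inr j} \<in> A \<Longrightarrow> g (\<rho> i) (\<gamma> j) = \<beta> A"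
          using emb[of g] by (auto simp: not_less)
        have "contains_subpattern ?G c' ?G' \<A>"
        proof (rule contains_subpattern_if_embedding[OF pat _ _ _ _ \<beta>])
          show "inj_on (\<lambda>i. I * p + \<rho> i) {..<m'}"
            using \<rho>(1) by (simp add: inj_on_def)
          show "(\<lambda>i. I * p + \<rho> i) ` {..<m'} \<subseteq> {..<m}"
            using \<rho>(2) rows by auto
          have "inj_on (e' \<circ> \<gamma>) {..<n'}"
            using \<gamma> e' by (intro comp_inj_on) (auto simp: bij_betw_def intro: inj_on_subset)
          then show "inj_on (\<lambda>j. J * q + e' (\<gamma> j)) {..<n'}"
            by (simp add: inj_on_def)
          have "e' (\<gamma> j) < q" if "j < n'" for j
            using \<gamma>(2) e' that by (auto simp: bij_betw_def)
          then show "(\<lambda>j. J * q + e' (\<gamma> j)) ` {..<n'} \<subseteq> {..<n}"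
            using cols by auto
        qed (use g in \<open>simp add: g_def\<close>)
        then show False
          using avoid by blast
      qed
      ultimately show "real (card ?B) \<le> a * (real p * real q)"
        by (simp add: q_def)
    qed
    moreover have "real m * real n = real (card R) + real (F_col m n c ?G' \<A>)"
    proof -
      have "{x \<in> edges ?G. c' x = c x} = (\<lambda>(i, j). {Inl i, Inr j}) ` R"
        by (auto simp: complete_bipartite_def R_def)
      then have "card {x \<in> edges ?G. c' x = c x} = card R"
        by (simp add: card_image inj_edge)
      moreover have "card (edges ?G) = card {x \<in> edges ?G. c' x = c x} + card {x \<in> edges ?G. c' x \<noteq> c x}"
        by (subst card_Un_disjoint[symmetric]) (auto simp: finite_edges intro: arg_cong[where f = card])
      ultimately show ?thesis
        using F by (simp add: card_edges flip: of_nat_mult of_nat_add)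
    qed
    ultimately show "real m * real n - (((real r - 1) / real s + \<delta>) * (real m * real n) + real p * real n + real q * real m)
        \<le> real (F_col m n c ?G' \<A>)"
      unfolding a_def by linarith
  qed
qed

text \<open>\<open>s\<close> edges are numbered from 0 and all others receive 0, a color already in
  use as \<open>0 < s\<close>. This makes the set under \<open>Max\<close> nonempty.\<close>

lemma exists_coloring_card:
  assumes "0 < s" "s \<le> m * n"
  shows "\<exists>c :: (nat + nat) set \<Rightarrow> nat. card (c ` edges (complete_bipartite m n)) = s"
proof -
  obtain K where "K \<subseteq> edges (complete_bipartite m n)" "card K = s"
    using obtain_subset_with_card_n[of s "edges (complete_bipartite m n)"] assms by (auto simp: card_edges)
  moreover from this obtain b where "bij_betw b K {0..<s}"
    using ex_bij_betw_finite_nat[of K] finite_subset[OF _ finite_edges] by blast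
  ultimately have K: "K \<subseteq> edges (complete_bipartite m n)" "b ` K = {0..<s}"
    by (auto simp: bij_betw_def)
  have "(\<lambda>e. if e \<in> K then b e else 0) ` edges (complete_bipartite m n) = {0..<s}" (is "?c ` _ = _")
  proof
    show "?c ` edges (complete_bipartite m n) \<subseteq> {0..<s}"
      using K(2) assms(1) by auto
    have "?c ` K = {0..<s}"
      using K(2) by simp
    then show "{0..<s} \<subseteq> ?c ` edges (complete_bipartite m n)"
      using image_mono[OF K(1), of ?c] by simp
  qed
  then show ?thesis
    by (metis card_atLeastLessThan diff_zero)
qed

theorem theorem1p2:
  fixes \<epsilon> :: real and m' n' s r :: nat and \<A> :: "(nat + nat) set set set"
  assumes "0 < \<epsilon>" and "\<epsilon> < 1"
    and "0 < m'" and "0 < n'" and "0 < s" and "0 < r" and "r \<le> s"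
    and "edge_pattern (complete_bipartite m' n') r \<A>"
    and "2 \<le> r"
  shows "\<exists>N. \<forall>m n :: nat. 0 < m \<longrightarrow> 0 < n \<longrightarrow> N \<le> m + n \<longrightarrow>
    (1 - \<epsilon> * (5 * real s + 2 + (real s + 1) * (real m / real n + real n / real m)))
        * ((real s - real r + 1) / real s) * (real m * real n)
      \<le> real (F_max m n s (complete_bipartite m' n') \<A>)
    \<and> real (F_max m n s (complete_bipartite m' n') \<A>)
      \<le> ((real s - real r + 1) / real s) * (real m * real n)"
proof -
  let ?G' = "complete_bipartite m' n'"
  note pat = assms(8) and r = \<open>2 \<le> r\<close> \<open>r \<le> s\<close>
  define \<rho> where "\<rho> = (real r - 1) / real s"
  have \<rho>: "(real s - real r + 1) / real s = 1 - \<rho>" and \<rho>s: "1 / real s \<le> 1 - \<rho>"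
    using r by (auto simp: \<rho>_def field_simps)
  \<comment> \<open>As \<open>1 - \<rho>\<close> is at least \<open>1 / s\<close>, this gives
    \<open>2 * \<delta> \<le> \<epsilon> * (1 - \<rho>)\<close>: one \<open>\<delta>\<close> for
    excess agreement in the blocks, one for the border.\<close>
  define \<delta> where "\<delta> = \<epsilon> / (2 * real s)"
  have \<delta>: "0 < \<delta>" "\<delta> \<le> 1"
    using assms r by (auto simp: \<delta>_def field_simps)
  obtain p q where pq: "0 < p" "0 < q" and low: "\<And>m n. 0 < m \<Longrightarrow> q \<le> n \<Longrightarrow>
    \<exists>c. card (c ` edges (complete_bipartite m n)) = s \<and>
      real m * real n - ((\<rho> + \<delta>) * (real m * real n) + real p * real n + real q * real m)
        \<le> real (F_col m n c ?G' \<A>)"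
    using exists_robust_coloring[OF \<delta> r pat] unfolding \<rho>_def by blast
  \<comment> \<open>Sides of length at least \<open>L\<close> bound the border loss
    \<open>p * n + q * m\<close> by \<open>\<delta> * (m * n)\<close> and satisfy
    \<open>q \<le> n\<close>.\<close>
  define L where "L = (real p + real q) * (2 / \<delta>)"
  have L: "real p \<le> \<delta> / 2 * L" "real q \<le> \<delta> / 2 * L" "real q \<le> L"
  proof -
    have "(real p + real q) * 1 \<le> (real p + real q) * (2 / \<delta>)"
      using \<delta> by (intro mult_left_mono) (auto simp: field_simps)
    then show "real q \<le> L"
      by (simp add: L_def)
  qed (use \<delta> in \<open>simp_all add: L_def\<close>)
  \<comment> \<open>The summand \<open>s + 1\<close> secures \<open>s \<le> m * n\<close>, because
    \<open>m + n \<le> m * n + 1\<close>. The other makes both sides at least \<open>L\<close> once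
    their ratios are at most \<open>1 / \<epsilon>\<close>.\<close>
  define N where "N = s + 1 + nat \<lceil>L * (1 + 1 / \<epsilon>)\<rceil>"
  have N: "L * (1 + 1 / \<epsilon>) \<le> real N"
    unfolding N_def by linarith
  show ?thesis
  proof (rule exI[of _ N], intro allI impI)
    fix m n :: nat
    assume m: "0 < m" and n: "0 < n" and mn: "N \<le> m + n"
    define X where "X = 5 * real s + 2 + (real s + 1) * (real m / real n + real n / real m)"
    define S where "S = {F_col m n c ?G' \<A> | c. card (c ` edges (complete_bipartite m n)) = s}"
    have finS: "finite S"
      unfolding S_def by (rule finite_F_col[OF pat r(1)])
    have Fmax: "F_max m n s ?G' \<A> = Max S"
      by (simp add: F_max_def S_def)
    have "m + n \<le> m * n + 1"
      using m n by (cases m; cases n) auto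
    then have "s \<le> m * n"
      using mn by (simp add: N_def)
    then have "S \<noteq> {}"
      using exists_coloring_card[OF \<open>0 < s\<close>] by (auto simp: S_def)
    then have "Max S \<in> S"
      using finS by simp
    then have upper: "real (F_max m n s ?G' \<A>) \<le> ((real s - real r + 1) / real s) * (real m * real n)"
      unfolding Fmax using F_col_upper[OF pat r] by (auto simp: S_def)
    have mnpos: "0 < real m * real n"
      using m n by simp
    \<comment> \<open>If the first factor is nonpositive, the bound is trivial; otherwise
      \<open>m / n\<close> and \<open>n / m\<close> are at most
      \<open>1 / \<epsilon>\<close>.\<close>
    have "(1 - \<epsilon> * X) * (1 - \<rho>) * (real m * real n) \<le> real (F_max m n s ?G' \<A>)"
    proof (cases "1 - \<epsilon> * X \<le> 0")
      case True
      have "0 \<le> 1 - \<rho>"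
        using \<rho>s by (rule order_trans[rotated]) simp
      then have "(1 - \<epsilon> * X) * (1 - \<rho>) * (real m * real n) \<le> 0"
        using True mnpos by (intro mult_nonpos_nonneg) auto
      then show ?thesis
        by (rule order_trans) simp
    next
      case False
      have quot: "0 \<le> real m / real n" "0 \<le> real n / real m"
        by auto
      have "1 * (real m / real n + real n / real m) \<le> (real s + 1) * (real m / real n + real n / real m)"
        using quot by (intro mult_right_mono) auto
      then have "2 + (real m / real n + real n / real m) \<le> X"
        unfolding X_def mult_1 by (intro add_mono) auto
      then have X: "real m / real n \<le> X" "real n / real m \<le> X" "1 \<le> X"
        using quot by linarith+
      have "real m / real n * \<epsilon> \<le> 1" "real n / real m * \<epsilon> \<le> 1"
        using False X(1,2)[THEN mult_left_mono, of \<epsilon>] assms(1) by (simp_all add: mult.commute)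
      then have ratio: "real m \<le> real n * (1 / \<epsilon>)" "real n \<le> real m * (1 / \<epsilon>)"
        using m n assms(1) by (simp_all add: field_simps)
      have sum: "L * (1 + 1 / \<epsilon>) \<le> real m + real n"
        using N mn by (metis of_nat_add of_nat_le_iff order_trans)
      have "L * (1 + 1 / \<epsilon>) \<le> real n * (1 + 1 / \<epsilon>)" "L * (1 + 1 / \<epsilon>) \<le> real m * (1 + 1 / \<epsilon>)"
        using sum ratio by (simp_all add: distrib_left)
      then have Lmn: "L \<le> real n" "L \<le> real m"
        using assms(1) by (simp_all add: add_pos_pos mult_le_cancel_right)
      have "q \<le> n"
        using Lmn L(3) by linarith
      then obtain c where c: "card (c ` edges (complete_bipartite m n)) = s"
        and Fc: "real m * real n - ((\<rho> + \<delta>) * (real m * real n) + real p * real n + real q * real m)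
          \<le> real (F_col m n c ?G' \<A>)"
        using low[OF m] by blast
      have "F_col m n c ?G' \<A> \<le> F_max m n s ?G' \<A>"
        unfolding Fmax using finS c by (intro Max_ge) (auto simp: S_def)
      then have Fc': "real (F_col m n c ?G' \<A>) \<le> real (F_max m n s ?G' \<A>)"
        by simp
      have "real p \<le> \<delta> / 2 * real m" "real q \<le> \<delta> / 2 * real n"
        using L(1,2) Lmn[THEN mult_left_mono, of "\<delta> / 2"] \<delta> by linarith+
      then have "real p * real n \<le> \<delta> / 2 * real m * real n" "real q * real m \<le> \<delta> / 2 * real n * real m"
        by (intro mult_right_mono; simp)+
      then have loss: "real p * real n + real q * real m \<le> \<delta> * (real m * real n)"
        by (simp add: algebra_simps)
      \<comment> \<open>By \<open>1 \<le> X\<close> the allowance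
        \<open>\<epsilon> * X * (1 - \<rho>)\<close> covers both losses of
        \<open>\<delta>\<close>.\<close>
      have "\<epsilon> * (1 / real s) \<le> \<epsilon> * (1 - \<rho>)"
        using \<rho>s assms(1) by (intro mult_left_mono) auto
      then have "2 * \<delta> \<le> \<epsilon> * (1 - \<rho>)"
        by (simp add: \<delta>_def)
      moreover have "\<epsilon> * (1 - \<rho>) \<le> \<epsilon> * X * (1 - \<rho>)"
        using X(3) assms(1) \<rho>s order_trans[OF _ \<rho>s, of 0] by (intro mult_right_mono) auto
      ultimately have "(1 - \<epsilon> * X) * (1 - \<rho>) \<le> 1 - \<rho> - 2 * \<delta>"
        by (simp add: algebra_simps)
      then have "(1 - \<epsilon> * X) * (1 - \<rho>) * (real m * real n) \<le> (1 - \<rho> - 2 * \<delta>) * (real m * real n)"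
        using mnpos by (intro mult_right_mono) auto
      also have "\<dots> \<le> real m * real n - ((\<rho> + \<delta>) * (real m * real n) + real p * real n + real q * real m)"
        using loss by (simp add: algebra_simps)
      finally show ?thesis
        using Fc Fc' by linarith
    qed
    then show "(1 - \<epsilon> * (5 * real s + 2 + (real s + 1) * (real m / real n + real n / real m)))
        * ((real s - real r + 1) / real s) * (real m * real n)
      \<le> real (F_max m n s ?G' \<A>)
    \<and> real (F_max m n s ?G' \<A>) \<le> ((real s - real r + 1) / real s) * (real m * real n)"
      using upper unfolding \<rho> X_def by blast
  qed
qed

end
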